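(* There is a uniform, deterministic algorithm in the parallel independence-oracle model that, for any cographic matroid on $m$ elements, finds a basis using $O(\log(m)\log\log(m))$ rounds, with $2^{O(\log^2(m))}$ independence queries per round.
   Context: A cographic matroid on ground set $E$ ($|E|=m$) comes from an (unknown) graph $G=(V,E)$: a set $S\subseteq E$ is independent iff $S$ does not contain all edges of any non-empty cut of $G$ (equivalently, there is a spanning forest $F$ of $G$ with $S\cap F=\emptyset$); a basis is an inclusion-maximal independent set (the complement of a spanning forest). A cut is the set of edges between some $S\subseteq V$ and $V\setminus S$. The algorithm has access to the matroid only through an independence oracle $\mathrm{Ind}:2^E\to\{0,1\}$, $\mathrm{Ind}(S)=1$ iff $S$ is independent. It operates in rounds: in each round it submits a batch of queries (subsets of $E$), chosen as a function of $m$ and the answers received in previous rounds, and then receives all answers. Uniform and deterministic means the queries and output are computed by a single fixed explicit deterministic procedure (no randomness, no non-uniform advice). *)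

theory Defs
  imports Complex_Main "HOL-Library.Nat_Bijection" "HOL-Library.Landau_Symbols"
begin

text \<open>
  Finite multigraphs with edge set \<open>E\<close>: \<open>ends e\<close> is the set of endpoints of the edge \<open>e\<close>, a
  singleton for a loop. Loops and parallel edges are needed to obtain all cographic matroids: a
  loop of the graph is a coloop of its cographic matroid.
\<close>

definition multigraph :: "'v set \<Rightarrow> 'e set \<Rightarrow> ('e \<Rightarrow> 'v set) \<Rightarrow> bool" where
  "multigraph V E ends \<longleftrightarrow>
     finite V \<and> finite E \<and> (\<forall>e\<in>E. ends e \<subseteq> V \<and> card (ends e) \<in> {1, 2})"

definition cut :: "'v set \<Rightarrow> 'e set \<Rightarrow> ('e \<Rightarrow> 'v set) \<Rightarrow> 'v set \<Rightarrow> 'e set" where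
  "cut V E ends S = {e \<in> E. ends e \<inter> S \<noteq> {} \<and> ends e \<inter> (V - S) \<noteq> {}}"

definition cographic_indep :: "'v set \<Rightarrow> 'e set \<Rightarrow> ('e \<Rightarrow> 'v set) \<Rightarrow> 'e set set" where
  "cographic_indep V E ends =
     {I. I \<subseteq> E \<and> \<not> (\<exists>S\<subseteq>V. cut V E ends S \<noteq> {} \<and> cut V E ends S \<subseteq> I)}"

text \<open>
  \<open>\<I>\<close> is the family of independent sets. Taking the vertices to be natural numbers is no
  restriction, since the graphs are finite.
\<close>

definition cographic_matroid :: "'e set \<Rightarrow> 'e set set \<Rightarrow> bool" where
  "cographic_matroid E \<I> \<longleftrightarrow>
     (\<exists>(V :: nat set) ends. multigraph V E ends \<and> \<I> = cographic_indep V E ends)"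

definition basis :: "'e set set \<Rightarrow> 'e set \<Rightarrow> bool" where
  "basis \<I> B \<longleftrightarrow> B \<in> \<I> \<and> (\<forall>I\<in>\<I>. B \<subseteq> I \<longrightarrow> I = B)"

text \<open>
  An algorithm maps the size \<open>m\<close> of the ground set \<open>{..<m}\<close> and the answers received so far (one
  list of answers per past round, oldest round first) to its next action: a batch of queries, or
  the final output.
\<close>

datatype action = Query "nat set list" | Output "nat set"

type_synonym algorithm = "nat \<Rightarrow> bool list list \<Rightarrow> action"

primrec transcript :: "algorithm \<Rightarrow> nat \<Rightarrow> (nat set \<Rightarrow> bool) \<Rightarrow> nat \<Rightarrow> bool list list" where
  "transcript A m Ind 0 = []"
| "transcript A m Ind (Suc k) =
     (let h = transcript A m Ind k
      in case A m h of Query Qs \<Rightarrow> h @ [map Ind Qs] | Output B \<Rightarrow> h)"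

definition halts_with ::
    "algorithm \<Rightarrow> nat \<Rightarrow> (nat set \<Rightarrow> bool) \<Rightarrow> nat \<Rightarrow> nat \<Rightarrow> nat set \<Rightarrow> bool" where
  "halts_with A m Ind k q B \<longleftrightarrow>
     (\<forall>j<k. \<exists>Qs. A m (transcript A m Ind j) = Query Qs \<and> length Qs \<le> q \<and>
                 (\<forall>S\<in>set Qs. S \<subseteq> {..<m})) \<and>
     A m (transcript A m Ind k) = Output B"

text \<open>
  The total recursive functions of each arity \<open>n\<close>, as functions on lists; only the values on lists
  of length \<open>n\<close> are meaningful. Minimisation is restricted to the case where it is everywhere
  defined, which by Kleene's normal form theorem still yields every total computable function.
\<close>

inductive total_recursive :: "nat \<Rightarrow> (nat list \<Rightarrow> nat) \<Rightarrow> bool" where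
  rec_zero: "total_recursive n (\<lambda>xs. 0)"
| rec_suc: "total_recursive 1 (\<lambda>xs. Suc (xs ! 0))"
| rec_proj: "i < n \<Longrightarrow> total_recursive n (\<lambda>xs. xs ! i)"
| rec_comp: "total_recursive (length gs) f \<Longrightarrow> \<forall>g\<in>set gs. total_recursive n g \<Longrightarrow>
    total_recursive n (\<lambda>xs. f (map (\<lambda>g. g xs) gs))"
| rec_prim: "total_recursive n f \<Longrightarrow> total_recursive (Suc (Suc n)) g \<Longrightarrow>
    total_recursive (Suc n) (\<lambda>xs. rec_nat (f (tl xs)) (\<lambda>k r. g (k # r # tl xs)) (hd xs))"
| rec_mu: "total_recursive (Suc n) f \<Longrightarrow> \<forall>xs. length xs = n \<longrightarrow> (\<exists>y. f (y # xs) = 0) \<Longrightarrow>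
    total_recursive n (\<lambda>xs. LEAST y. f (y # xs) = 0)"

definition answers_encode :: "bool list list \<Rightarrow> nat" where
  "answers_encode h = list_encode (map (\<lambda>as. list_encode (map of_bool as)) h)"

definition action_decode :: "nat \<Rightarrow> action" where
  "action_decode c = (case sum_decode c of
     Inl q \<Rightarrow> Query (map set_decode (list_decode q))
   | Inr b \<Rightarrow> Output (set_decode b))"

text \<open>
  One recursive function computes the next action for all ground set sizes \<open>m\<close> at once, so the
  algorithm has no access to advice depending on \<open>m\<close>.
\<close>

definition uniform_algorithm :: "algorithm \<Rightarrow> bool" where
  "uniform_algorithm A \<longleftrightarrow>
     (\<exists>F. total_recursive 2 F \<and> (\<forall>m h. A m h = action_decode (F [m, answers_encode h])))"

end

theory Submission imports Defs begin

text \<open>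
  Deleting an edge of the graph puts it into the basis, contracting it puts it into the spanning
  forest; the aim is to halve the number of undecided edges in two rounds. Let \<open>k\<close> be a large
  multiple of \<open>log m\<close>. The first round tests all sets of at most \<open>k\<close> undecided edges, which reveals
  all cuts of that size. The edges with the smallest label in these cuts form a forest, so they can be contracted,
  and afterwards every cut has more than \<open>k\<close> edges.

  In a graph in which all cuts are that large, a bucket of a multiplicative hash function with
  \<open>6 * k\<close> buckets meets the boundary of a component with constant probability. Hence some bucket,
  containing a fraction \<open>O(1/k)\<close> of the edges, meets a constant fraction of the boundaries, and adding
  it reduces the number of components by a constant factor. So the union of \<open>O(log m)\<close> buckets
  connects the graph while containing at most half of the edges. There are only \<open>2 ^ O((log m)\<^sup>2)\<close>
  such unions; the second round tests all their complements and deletes one that is independent.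
\<close>

section \<open>Recursive functions\<close>

text \<open>The smallest labels form a forest by parity: a cut meets a cycle in an even number of
  edges. If a cycle consisted of new minima and of edges contracted before, the cut belonging to its
  largest new minimum would meet it in that edge alone. Neither cycles nor spanning forests appear
  in the formal proof; cuts alone certify the forest, and cuts are also what the oracle sees. The
  obstacle is to sample without randomness or advice. The hash family has polynomially many members
  and needs no prime, and an averaging argument supplies a good bucket at each stage. Which bucket
  is good depends on the unknown graph and on the buckets chosen before, but this adaptivity lives
  only in the analysis: all sequences of buckets are tried in one round, and the answers together
  with a count of the edges show which one to accept. Uniformity is a statement about recursive
  functions on codes, which is why edge sets, states and batches are all represented by
  numbers.\<close>

definition rec_fun :: "nat \<Rightarrow> (nat list \<Rightarrow> nat) \<Rightarrow> bool" where
  "rec_fun n f \<longleftrightarrow> (\<exists>F. total_recursive n F \<and> (\<forall>xs. length xs = n \<longrightarrow> F xs = f xs))"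

lemma rec_funI: "total_recursive n f \<Longrightarrow> rec_fun n f"
  unfolding rec_fun_def by blast

lemma rec_fun_cong:
  assumes "rec_fun n f" "\<And>xs. length xs = n \<Longrightarrow> f xs = g xs"
  shows "rec_fun n g"
proof -
  from assms(1) obtain F where "total_recursive n F" "\<forall>xs. length xs = n \<longrightarrow> F xs = f xs"
    unfolding rec_fun_def by blast
  with assms(2) show ?thesis unfolding rec_fun_def by auto
qed

lemma rec_fun_comp:
  assumes f: "rec_fun (length gs) f" and gs: "\<forall>g\<in>set gs. rec_fun n g"
  shows "rec_fun n (\<lambda>xs. f (map (\<lambda>g. g xs) gs))"
proof -
  from gs obtain p where
    p: "\<And>g. g \<in> set gs \<Longrightarrow> total_recursive n (p g) \<and> (\<forall>xs. length xs = n \<longrightarrow> p g xs = g xs)"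
    unfolding rec_fun_def by metis
  from f obtain F where F: "total_recursive (length gs) F"
    "\<And>xs. length xs = length gs \<Longrightarrow> F xs = f xs"
    unfolding rec_fun_def by blast
  have "total_recursive n (\<lambda>xs. F (map (\<lambda>g. g xs) (map p gs)))"
    by (rule rec_comp) (use F p in auto)
  moreover have "F (map (\<lambda>g. g xs) (map p gs)) = f (map (\<lambda>g. g xs) gs)" if "length xs = n" for xs
  proof -
    have "map (\<lambda>g. g xs) (map p gs) = map (\<lambda>g. g xs) gs" using p that by simp
    then show ?thesis using F(2)[of "map (\<lambda>g. g xs) gs"] by (simp only: length_map)
  qed
  ultimately show ?thesis unfolding rec_fun_def by blast
qed

lemma rec_fun_proj: "i < n \<Longrightarrow> rec_fun n (\<lambda>xs. xs ! i)"
  by (rule rec_funI, rule rec_proj)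

lemma rec_fun_zero: "rec_fun n (\<lambda>xs. 0)"
  by (rule rec_funI, rule rec_zero)

lemma rec_fun_Suc: "rec_fun n a \<Longrightarrow> rec_fun n (\<lambda>xs. Suc (a xs))"
  using rec_fun_comp[of "[a]" "\<lambda>xs. Suc (xs ! 0)" n] rec_suc by (simp add: rec_funI)

lemma map_proj: "length xs = n \<Longrightarrow> map (\<lambda>g. g xs) (map (\<lambda>i xs. xs ! i) [0..<n]) = xs"
  by (auto simp: comp_def intro: nth_equalityI)

text \<open>Primitive recursion puts the counter and the accumulator in front of the parameters;
  this rule lets a step function read the parameters behind them.\<close>

lemma rec_fun_tl_tl:
  assumes "rec_fun n a"
  shows "rec_fun (Suc (Suc n)) (\<lambda>ys. a (tl (tl ys)))"
proof -
  let ?gs = "map (\<lambda>i ys. ys ! Suc (Suc i)) [0..<n] :: (nat list \<Rightarrow> nat) list"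
  have "rec_fun (Suc (Suc n)) (\<lambda>ys. a (map (\<lambda>g. g ys) ?gs))"
    by (rule rec_fun_comp) (use assms in \<open>auto intro: rec_fun_proj\<close>)
  then show ?thesis
  proof (rule rec_fun_cong)
    fix ys :: "nat list" assume "length ys = Suc (Suc n)"
    then have "map (\<lambda>g. g ys) ?gs = tl (tl ys)"
      by (intro nth_equalityI) (auto simp: nth_tl)
    then show "a (map (\<lambda>g. g ys) ?gs) = a (tl (tl ys))" by simp
  qed
qed

lemma rec_fun_rec_nat:
  assumes a: "rec_fun n a" and g: "rec_fun (Suc (Suc n)) g" and c: "rec_fun n c"
  shows "rec_fun n (\<lambda>xs. rec_nat (a xs) (\<lambda>k r. g (k # r # xs)) (c xs))"
proof -
  from a obtain A where A: "total_recursive n A" "\<And>xs. length xs = n \<Longrightarrow> A xs = a xs"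
    unfolding rec_fun_def by blast
  from g obtain G where G: "total_recursive (Suc (Suc n)) G"
    "\<And>xs. length xs = Suc (Suc n) \<Longrightarrow> G xs = g xs"
    unfolding rec_fun_def by blast
  let ?h = "\<lambda>xs. rec_nat (A (tl xs)) (\<lambda>k r. G (k # r # tl xs)) (hd xs)"
  \<comment> \<open>\<open>rec_prim\<close> recurses on the head of its argument list;
    \<open>c\<close> followed by all projections turns \<open>xs\<close> into
    \<open>c xs # xs\<close>.\<close>
  let ?gs = "c # map (\<lambda>i xs. xs ! i) [0..<n]"
  have "rec_fun n (\<lambda>xs. ?h (map (\<lambda>g. g xs) ?gs))"
    by (rule rec_fun_comp)
      (use rec_prim[OF A(1) G(1)] c in \<open>auto intro: rec_fun_proj rec_funI\<close>)
  then show ?thesis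
  proof (rule rec_fun_cong)
    fix xs :: "nat list" assume l: "length xs = n"
    have m: "map (\<lambda>g. g xs) ?gs = c xs # xs" using map_proj[OF l] by simp
    show "?h (map (\<lambda>g. g xs) ?gs) = rec_nat (a xs) (\<lambda>k r. g (k # r # xs)) (c xs)"
      unfolding m using A(2) G(2) l by simp
  qed
qed

lemma rec_fun_LEAST:
  assumes g: "rec_fun (Suc n) g" and ex: "\<And>xs. length xs = n \<Longrightarrow> \<exists>y. g (y # xs) = 0"
  shows "rec_fun n (\<lambda>xs. LEAST y. g (y # xs) = 0)"
proof -
  from g obtain G where G: "total_recursive (Suc n) G"
    "\<And>xs. length xs = Suc n \<Longrightarrow> G xs = g xs"
    unfolding rec_fun_def by blast
  have "total_recursive n (\<lambda>xs. LEAST y. G (y # xs) = 0)"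
    by (rule rec_mu[OF G(1)]) (use G(2) ex in auto)
  then show ?thesis unfolding rec_fun_def using G(2) by force
qed

lemma rec_fun_add: "rec_fun n a \<Longrightarrow> rec_fun n b \<Longrightarrow> rec_fun n (\<lambda>xs. a xs + b xs)"
proof -
  assume a: "rec_fun n a" and b: "rec_fun n b"
  have "rec_fun (Suc (Suc n)) (\<lambda>ys. Suc (ys ! 1))" by (intro rec_fun_Suc rec_fun_proj) simp
  from rec_fun_rec_nat[OF a this b] show ?thesis
  proof (rule rec_fun_cong)
    fix xs
    have "rec_nat (a xs) (\<lambda>k r. Suc ((k # r # xs) ! 1)) c = a xs + c" for c
      by (induction c) auto
    then show "rec_nat (a xs) (\<lambda>k r. Suc ((k # r # xs) ! 1)) (b xs) = a xs + b xs" .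
  qed
qed

lemma rec_fun_mult: "rec_fun n a \<Longrightarrow> rec_fun n b \<Longrightarrow> rec_fun n (\<lambda>xs. a xs * b xs)"
proof -
  assume a: "rec_fun n a" and b: "rec_fun n b"
  have "rec_fun (Suc (Suc n)) (\<lambda>ys. ys ! 1 + a (tl (tl ys)))"
    by (intro rec_fun_add rec_fun_proj rec_fun_tl_tl a) simp
  from rec_fun_rec_nat[OF rec_fun_zero this b] show ?thesis
  proof (rule rec_fun_cong)
    fix xs
    have "rec_nat 0 (\<lambda>k r. (k # r # xs) ! 1 + a (tl (tl (k # r # xs)))) c = a xs * c" for c
      by (induction c) auto
    then show "rec_nat 0 (\<lambda>k r. (k # r # xs) ! 1 + a (tl (tl (k # r # xs)))) (b xs) = a xs * b xs" .
  qed
qed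

lemma rec_fun_pred: "rec_fun n a \<Longrightarrow> rec_fun n (\<lambda>xs. a xs - 1)"
proof -
  assume a: "rec_fun n a"
  have "rec_fun (Suc (Suc n)) (\<lambda>ys. ys ! 0)" by (intro rec_fun_proj) simp
  from rec_fun_rec_nat[OF rec_fun_zero this a] show ?thesis
  proof (rule rec_fun_cong)
    fix xs show "rec_nat 0 (\<lambda>k r. (k # r # xs) ! 0) (a xs) = a xs - 1"
      by (cases "a xs") auto
  qed
qed

lemma rec_fun_diff: "rec_fun n a \<Longrightarrow> rec_fun n b \<Longrightarrow> rec_fun n (\<lambda>xs. a xs - b xs)"
proof -
  assume a: "rec_fun n a" and b: "rec_fun n b"
  have "rec_fun (Suc (Suc n)) (\<lambda>ys. ys ! 1 - 1)" by (intro rec_fun_pred rec_fun_proj) simp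
  from rec_fun_rec_nat[OF a this b] show ?thesis
  proof (rule rec_fun_cong)
    fix xs
    have "rec_nat (a xs) (\<lambda>k r. (k # r # xs) ! 1 - 1) c = a xs - c" for c
      by (induction c) auto
    then show "rec_nat (a xs) (\<lambda>k r. (k # r # xs) ! 1 - 1) (b xs) = a xs - b xs" .
  qed
qed

section \<open>Cantor pairing and its inverse\<close>

lemma rec_fun_triangle: "rec_fun n a \<Longrightarrow> rec_fun n (\<lambda>xs. triangle (a xs))"
proof -
  assume a: "rec_fun n a"
  have "rec_fun (Suc (Suc n)) (\<lambda>ys. ys ! 1 + Suc (ys ! 0))"
    by (intro rec_fun_add rec_fun_Suc rec_fun_proj) simp_all
  from rec_fun_rec_nat[OF rec_fun_zero this a] show ?thesis
  proof (rule rec_fun_cong)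
    fix xs
    have "rec_nat 0 (\<lambda>k r. (k # r # xs) ! 1 + Suc ((k # r # xs) ! 0)) c = triangle c" for c
      by (induction c) auto
    then show "rec_nat 0 (\<lambda>k r. (k # r # xs) ! 1 + Suc ((k # r # xs) ! 0)) (a xs) = triangle (a xs)" .
  qed
qed

lemma rec_fun_prod_encode:
  "rec_fun n a \<Longrightarrow> rec_fun n b \<Longrightarrow> rec_fun n (\<lambda>xs. prod_encode (a xs, b xs))"
  unfolding prod_encode_def by (simp add: rec_fun_add rec_fun_triangle)

definition pfst :: "nat \<Rightarrow> nat" where "pfst e = fst (prod_decode e)"
definition psnd :: "nat \<Rightarrow> nat" where "psnd e = snd (prod_decode e)"

lemma pfst_encode [simp]: "pfst (prod_encode (a, b)) = a"
  and psnd_encode [simp]: "psnd (prod_encode (a, b)) = b"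
  by (simp_all add: pfst_def psnd_def)

lemma triangle_mono: "a \<le> b \<Longrightarrow> triangle a \<le> triangle b"
  by (induction rule: dec_induct) auto

text \<open>The Cantor code of (a, b) is \<open>triangle (a + b) + a\<close>, at least
  \<open>triangle (a + b)\<close> and below \<open>triangle (Suc (a + b))\<close>, so the search
  recovers the diagonal a + b. Truncated subtraction turns
  \<open>Suc e \<le> triangle (Suc y)\<close> into an equation with 0, the form that minimisation
  needs.\<close>

lemma triangle_root: "(LEAST y. Suc e - triangle (Suc y) = 0) = pfst e + psnd e"
proof -
  obtain a b where e: "e = prod_encode (a, b)" by (metis prod.exhaust prod_decode_inverse)
  have "(LEAST y. Suc e - triangle (Suc y) = 0) = a + b"
  proof (rule Least_equality)
    show "Suc e - triangle (Suc (a + b)) = 0" by (simp add: e prod_encode_def)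
    fix y assume y: "Suc e - triangle (Suc y) = 0"
    show "a + b \<le> y"
    proof (rule ccontr)
      assume "\<not> a + b \<le> y"
      then have "triangle (Suc y) \<le> triangle (a + b)" by (intro triangle_mono) simp
      also have "\<dots> \<le> e" by (simp add: e prod_encode_def)
      finally show False using y by simp
    qed
  qed
  then show ?thesis by (simp add: e)
qed

lemma pfst_eq: "pfst e = e - triangle (LEAST y. Suc e - triangle (Suc y) = 0)"
  and psnd_eq: "psnd e = (LEAST y. Suc e - triangle (Suc y) = 0) - pfst e"
proof -
  obtain a b where e: "e = prod_encode (a, b)" by (metis prod.exhaust prod_decode_inverse)
  show "pfst e = e - triangle (LEAST y. Suc e - triangle (Suc y) = 0)"
    unfolding triangle_root by (simp add: e) (simp add: prod_encode_def)
  show "psnd e = (LEAST y. Suc e - triangle (Suc y) = 0) - pfst e"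
    unfolding triangle_root by simp
qed

lemma rec_fun_root: "rec_fun 1 (\<lambda>xs. LEAST y. Suc (xs ! 0) - triangle (Suc y) = 0)"
proof -
  have "rec_fun (Suc 1) (\<lambda>ys. Suc (ys ! 1) - triangle (Suc (ys ! 0)))"
    by (intro rec_fun_diff rec_fun_triangle rec_fun_Suc rec_fun_proj) simp_all
  then have "rec_fun 1 (\<lambda>xs. LEAST y. Suc ((y # xs) ! 1) - triangle (Suc ((y # xs) ! 0)) = 0)"
  proof (rule rec_fun_LEAST)
    fix xs :: "nat list"
    have "n \<le> triangle n" for n by (induction n) auto
    from this[of "Suc (xs ! 0)"]
    show "\<exists>y. Suc ((y # xs) ! 1) - triangle (Suc ((y # xs) ! 0)) = 0"
      by (intro exI[of _ "xs ! 0"]) simp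
  qed
  then show ?thesis by simp
qed

text \<open>
  Computability is developed for unary functions only: an environment with several variables is a
  nested pair, and a binder pushes its variable onto the environment. All closure rules then apply
  by resolution.
\<close>

definition computable :: "(nat \<Rightarrow> nat) \<Rightarrow> bool" where
  "computable f \<longleftrightarrow> rec_fun 1 (\<lambda>xs. f (xs ! 0))"

definition decidable :: "(nat \<Rightarrow> bool) \<Rightarrow> bool" where
  "decidable P \<longleftrightarrow> computable (\<lambda>e. of_bool (P e))"

lemma rec_fun_computable:
  assumes "computable f" "rec_fun n a"
  shows "rec_fun n (\<lambda>xs. f (a xs))"
  using rec_fun_comp[of "[a]" "\<lambda>xs. f (xs ! 0)" n] assms by (simp add: computable_def)

lemma computable_comp: "computable f \<Longrightarrow> computable g \<Longrightarrow> computable (\<lambda>e. f (g e))"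
  unfolding computable_def[of g] computable_def[of "\<lambda>e. f (g e)"] by (rule rec_fun_computable)

lemma computable_cong: "computable f \<Longrightarrow> (\<And>x. f x = g x) \<Longrightarrow> computable g"
  by (subgoal_tac "f = g") auto

lemma computable_pfst_raw: "computable pfst" and computable_psnd_raw: "computable psnd"
proof -
  have "rec_fun 1 (\<lambda>xs. xs ! 0 - triangle (LEAST y. Suc (xs ! 0) - triangle (Suc y) = 0))"
    by (intro rec_fun_diff rec_fun_triangle rec_fun_proj rec_fun_root) simp
  then show 1: "computable pfst" unfolding computable_def pfst_eq .
  have "rec_fun 1 (\<lambda>xs. (LEAST y. Suc (xs ! 0) - triangle (Suc y) = 0) - pfst (xs ! 0))"
    by (intro rec_fun_diff rec_fun_root 1[unfolded computable_def])
  then show "computable psnd" unfolding computable_def psnd_eq .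
qed

section \<open>Closure rules for unary computable functions\<close>

named_theorems comp

lemma computable_id [comp]: "computable (\<lambda>e. e)"
  unfolding computable_def by (rule rec_fun_proj) simp

lemma computable_const [comp]: "computable (\<lambda>e. c)"
  unfolding computable_def by (induction c) (auto intro: rec_fun_zero rec_fun_Suc)

lemma computable_Suc [comp]: "computable f \<Longrightarrow> computable (\<lambda>e. Suc (f e))"
  unfolding computable_def by (rule rec_fun_Suc)

lemma computable_add [comp]: "computable f \<Longrightarrow> computable g \<Longrightarrow> computable (\<lambda>e. f e + g e)"
  unfolding computable_def by (rule rec_fun_add)

lemma computable_mult [comp]: "computable f \<Longrightarrow> computable g \<Longrightarrow> computable (\<lambda>e. f e * g e)"
  unfolding computable_def by (rule rec_fun_mult)

lemma computable_diff [comp]: "computable f \<Longrightarrow> computable g \<Longrightarrow> computable (\<lambda>e. f e - g e)"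
  unfolding computable_def by (rule rec_fun_diff)

lemma computable_prod_encode [comp]:
  "computable f \<Longrightarrow> computable g \<Longrightarrow> computable (\<lambda>e. prod_encode (f e, g e))"
  unfolding computable_def by (rule rec_fun_prod_encode)

lemma computable_pfst [comp]: "computable f \<Longrightarrow> computable (\<lambda>e. pfst (f e))"
  by (rule computable_comp[OF computable_pfst_raw])

lemma computable_psnd [comp]: "computable f \<Longrightarrow> computable (\<lambda>e. psnd (f e))"
  by (rule computable_comp[OF computable_psnd_raw])

lemma computable_rec_nat [comp]:
  assumes a: "computable a" and g: "computable (\<lambda>p. g (pfst p) (pfst (psnd p)) (psnd (psnd p)))"
    and c: "computable c"
  shows "computable (\<lambda>e. rec_nat (a e) (\<lambda>k r. g k r e) (c e))"
proof -
  let ?G = "\<lambda>p. g (pfst p) (pfst (psnd p)) (psnd (psnd p))"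
  have "rec_fun (Suc (Suc 1)) (\<lambda>ys. ?G (prod_encode (ys ! 0, prod_encode (ys ! 1, ys ! 2))))"
    by (rule rec_fun_computable[OF g]) (intro rec_fun_prod_encode rec_fun_proj; simp)
  from rec_fun_rec_nat[OF a[unfolded computable_def] this c[unfolded computable_def]]
  show ?thesis unfolding computable_def by simp
qed

text \<open>Kept out of \<open>comp\<close>, because termination of the search has to be proved in
  each case.\<close>

lemma computable_LEAST:
  assumes P: "decidable (\<lambda>p. P (pfst p) (psnd p))" and ex: "\<And>e. \<exists>y. P y e"
  shows "computable (\<lambda>e. LEAST y. P y e)"
proof -
  have c: "computable (\<lambda>p. 1 - of_bool (P (pfst p) (psnd p)))"
    using P unfolding decidable_def by (intro comp)
  have "rec_fun (Suc 1) (\<lambda>ys. 1 - of_bool (P (pfst (prod_encode (ys ! 0, ys ! 1)))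
      (psnd (prod_encode (ys ! 0, ys ! 1)))))"
    by (rule rec_fun_computable[OF c]) (intro rec_fun_prod_encode rec_fun_proj; simp)
  then have "rec_fun 1 (\<lambda>xs. LEAST y. 1 - of_bool (P
      (pfst (prod_encode ((y # xs) ! 0, (y # xs) ! 1)))
      (psnd (prod_encode ((y # xs) ! 0, (y # xs) ! 1)))) = (0 :: nat))"
    by (rule rec_fun_LEAST) (use ex in auto)
  moreover have "1 - of_bool Q = (0 :: nat) \<longleftrightarrow> Q" for Q by simp
  ultimately show ?thesis unfolding computable_def by simp
qed

lemma decidable_not [comp]: "decidable P \<Longrightarrow> decidable (\<lambda>e. \<not> P e)"
  unfolding decidable_def of_bool_not_iff
  by (rule computable_cong[of "\<lambda>e. 1 - of_bool (P e)"]) (intro comp, auto)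

lemma decidable_conj [comp]: "decidable P \<Longrightarrow> decidable Q \<Longrightarrow> decidable (\<lambda>e. P e \<and> Q e)"
  unfolding decidable_def of_bool_conj by (rule computable_mult)

lemma decidable_disj [comp]:
  assumes "decidable P" "decidable Q" shows "decidable (\<lambda>e. P e \<or> Q e)"
  using decidable_not[OF decidable_conj[OF assms[THEN decidable_not]]] by simp

lemma decidable_imp [comp]:
  assumes "decidable P" "decidable Q" shows "decidable (\<lambda>e. P e \<longrightarrow> Q e)"
  using decidable_not[OF decidable_conj[OF assms(1) decidable_not[OF assms(2)]]] by simp

lemma decidable_iff [comp]:
  assumes "decidable P" "decidable Q" shows "decidable (\<lambda>e. P e \<longleftrightarrow> Q e)"
proof -
  have "decidable (\<lambda>e. (P e \<longrightarrow> Q e) \<and> (Q e \<longrightarrow> P e))" by (intro comp assms)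
  moreover have "(P e \<longrightarrow> Q e) \<and> (Q e \<longrightarrow> P e) \<longleftrightarrow> (P e \<longleftrightarrow> Q e)" for e by blast
  ultimately show ?thesis by simp
qed

lemma decidable_less [comp]:
  assumes "computable f" "computable g" shows "decidable (\<lambda>e. f e < g e)"
  unfolding decidable_def
  by (rule computable_cong[of "\<lambda>e. 1 - (1 - (g e - f e))"]) (intro comp assms, simp)

lemma decidable_le [comp]:
  assumes "computable f" "computable g" shows "decidable (\<lambda>e. f e \<le> g e)"
  using decidable_not[OF decidable_less[OF assms(2,1)]] by (simp add: not_less)

lemma decidable_eq [comp]:
  assumes "computable f" "computable g" shows "decidable (\<lambda>e. f e = g e)"
proof -
  have "(\<lambda>e. f e = g e) = (\<lambda>e. f e \<le> g e \<and> g e \<le> f e)" by auto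
  then show ?thesis using decidable_conj[OF decidable_le[OF assms] decidable_le[OF assms(2,1)]] by simp
qed

lemma computable_if [comp]:
  assumes "decidable P" "computable f" "computable g"
  shows "computable (\<lambda>e. if P e then f e else g e)"
  by (rule computable_cong[of "\<lambda>e. of_bool (P e) * f e + (1 - of_bool (P e)) * g e"])
    (intro comp assms[unfolded decidable_def], auto)

lemma computable_of_bool [comp]: "decidable P \<Longrightarrow> computable (\<lambda>e. of_bool (P e))"
  by (simp add: decidable_def)

text \<open>Bounded sums carry most of what follows: bounded quantifiers, cardinalities, division
  and set codes are all rewritten as sums of truth values.\<close>

lemma computable_sum [comp]:
  assumes "computable (\<lambda>p. f (pfst p) (psnd p))" "computable n"
  shows "computable (\<lambda>e. \<Sum>x<n e. f x e)"
proof (rule computable_cong)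
  \<comment> \<open>In the recursion the accumulator sits between the index and \<open>e\<close>;
    the body has to skip it.\<close>
  have c: "computable (\<lambda>p. f (pfst p) (psnd (psnd p)))"
    using computable_comp[OF assms(1), of "\<lambda>p. prod_encode (pfst p, psnd (psnd p))"]
    by (simp add: comp)
  show "computable (\<lambda>e. rec_nat 0 (\<lambda>k r. r + f k e) (n e))"
    by (intro comp c assms)
  fix e
  have "rec_nat 0 (\<lambda>k r. r + f k e) m = (\<Sum>x<m. f x e)" for m
    by (induction m) auto
  then show "rec_nat 0 (\<lambda>k r. r + f k e) (n e) = (\<Sum>x<n e. f x e)" .
qed

lemma decidable_bex [comp]:
  assumes "decidable (\<lambda>p. P (pfst p) (psnd p))" "computable n"
  shows "decidable (\<lambda>e. \<exists>x<n e. P x e)"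
proof -
  have "decidable (\<lambda>e. 0 < (\<Sum>x<n e. of_bool (P x e) :: nat))"
    by (intro comp assms)
  moreover have "0 < (\<Sum>x<n e. of_bool (P x e) :: nat) \<longleftrightarrow> (\<exists>x<n e. P x e)" for e
    by (auto simp: sum_nonneg_eq_0_iff zero_less_iff_neq_zero)
  ultimately show ?thesis by simp
qed

lemma decidable_ball [comp]:
  assumes "decidable (\<lambda>p. P (pfst p) (psnd p))" "computable n"
  shows "decidable (\<lambda>e. \<forall>x<n e. P x e)"
  using decidable_not[OF decidable_bex[OF decidable_not[OF assms(1)] assms(2)]] by simp

lemma computable_power [comp]:
  assumes "computable f" "computable g"
  shows "computable (\<lambda>e. f e ^ g e)"
proof (rule computable_cong)
  show "computable (\<lambda>e. rec_nat 1 (\<lambda>k r. r * f e) (g e))"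
    by (intro comp assms computable_comp[OF assms(1)])
  fix e
  have "rec_nat 1 (\<lambda>k r. r * f e) m = f e ^ m" for m
    by (induction m) auto
  then show "rec_nat 1 (\<lambda>k r. r * f e) (g e) = f e ^ g e" .
qed

lemma card_Collect: "card {x :: nat. x < n \<and> P x} = (\<Sum>x<n. of_bool (P x))"
proof -
  have "{x. x < n \<and> P x} = {x \<in> {..<n}. P x}" by auto
  then have "card {x. x < n \<and> P x} = (\<Sum>x<n. if P x then 1 else 0)"
    using sum.inter_filter[of "{..<n}" "\<lambda>_. 1 :: nat" P] by simp
  also have "\<dots> = (\<Sum>x<n. of_bool (P x))" by (intro sum.cong) auto
  finally show ?thesis .
qed

text \<open>The counted \<open>x\<close> are exactly those below the quotient. The guard
  \<open>0 < b\<close> reproduces the convention that division by 0 gives 0.\<close>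

lemma div_eq_card: "(a :: nat) div b = (\<Sum>x<a. of_bool (0 < b \<and> Suc x * b \<le> a))"
proof (cases "b = 0")
  case False
  then have *: "Suc x * b \<le> a \<longleftrightarrow> x < a div b" for x
    by (metis Suc_le_eq less_eq_div_iff_mult_less_eq bot_nat_0.not_eq_extremum)
  have "x < a" if "x < a div b" for x using that div_le_dividend[of a b] by linarith
  then have "{x. x < a \<and> 0 < b \<and> Suc x * b \<le> a} = {..<a div b}"
    unfolding * using False by auto
  then show ?thesis using card_Collect[of a "\<lambda>x. 0 < b \<and> Suc x * b \<le> a"] by simp
qed simp

lemma computable_div [comp]:
  assumes "computable f" "computable g"
  shows "computable (\<lambda>e. f e div g e)"
  unfolding div_eq_card
  by (intro comp assms computable_comp[OF assms(1)] computable_comp[OF assms(2)])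

lemma computable_mod [comp]:
  assumes "computable f" "computable g"
  shows "computable (\<lambda>e. f e mod g e)"
  unfolding modulo_nat_def by (intro comp assms)

lemma decidable_set_decode [comp]:
  assumes "computable f" "computable g"
  shows "decidable (\<lambda>e. f e \<in> set_decode (g e))"
proof -
  have "decidable (\<lambda>e. g e div 2 ^ f e mod 2 = 1)" by (intro comp assms)
  then show ?thesis by (simp add: set_decode_def odd_iff_mod_2_eq_one)
qed

lemma set_encode_Collect: "set_encode {x. x < n \<and> P x} = (\<Sum>x<n. of_bool (P x) * 2 ^ x)"
proof -
  have "{x. x < n \<and> P x} = {x \<in> {..<n}. P x}" by auto
  then have "set_encode {x. x < n \<and> P x} = (\<Sum>x<n. if P x then 2 ^ x else 0)"
    by (simp only: set_encode_def sum.inter_filter finite_lessThan)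
  also have "\<dots> = (\<Sum>x<n. of_bool (P x) * 2 ^ x)" by (intro sum.cong) auto
  finally show ?thesis .
qed

lemma computable_set_encode [comp]:
  assumes "decidable (\<lambda>p. P (pfst p) (psnd p))" "computable n"
  shows "computable (\<lambda>e. set_encode {x. x < n e \<and> P x e})"
  unfolding set_encode_Collect by (intro comp assms)

lemma computable_card [comp]:
  assumes "decidable (\<lambda>p. P (pfst p) (psnd p))" "computable n"
  shows "computable (\<lambda>e. card {x. x < n e \<and> P x e})"
  unfolding card_Collect by (intro comp assms)

text \<open>A list code grows at the front, so the recursion runs backwards: after \<open>j\<close>
  steps it holds the code of the last \<open>j\<close> entries.\<close>

lemma list_encode_map_upt:
  "list_encode (map f [0..<n]) = rec_nat 0 (\<lambda>k r. Suc (prod_encode (f (n - Suc k), r))) n"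
proof -
  have "rec_nat 0 (\<lambda>k r. Suc (prod_encode (f (n - Suc k), r))) j = list_encode (map f [n - j..<n])"
    if "j \<le> n" for j
    using that
  proof (induction j)
    case (Suc j)
    then have "[n - Suc j..<n] = (n - Suc j) # [n - j..<n]"
      by (subst upt_conv_Cons) (auto simp: Suc_diff_Suc)
    then show ?case using Suc by simp
  qed simp
  from this[of n] show ?thesis by simp
qed

lemma computable_list_encode [comp]:
  assumes f: "computable (\<lambda>p. f (pfst p) (psnd p))" and n: "computable n"
  shows "computable (\<lambda>e. list_encode (map (\<lambda>x. f x e) [0..<n e]))"
proof -
  have "computable (\<lambda>p. f (n (psnd (psnd p)) - Suc (pfst p)) (psnd (psnd p)))"
    using computable_comp[OF f, of "\<lambda>p. prod_encode (n (psnd (psnd p)) - Suc (pfst p), psnd (psnd p))"]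
    by (simp add: comp computable_comp[OF n])
  then show ?thesis
    unfolding list_encode_map_upt by (intro comp n)
qed

text \<open>A nonempty list has the code \<open>Suc (prod_encode (head, tail code))\<close>, so
  \<open>psnd (r - 1)\<close> is the tail. The empty list has code 0, and 0 is a fixed point of the
  step.\<close>

definition list_drop :: "nat \<Rightarrow> nat \<Rightarrow> nat" where
  "list_drop n c = rec_nat c (\<lambda>k r. psnd (r - 1)) n"

definition list_nth :: "nat \<Rightarrow> nat \<Rightarrow> nat" where
  "list_nth c n = pfst (list_drop n c - 1)"

definition list_len :: "nat \<Rightarrow> nat" where
  "list_len c = (LEAST n. list_drop n c = 0)"

lemma list_drop_encode: "list_drop n (list_encode xs) = list_encode (drop n xs)"
proof (induction n)
  case (Suc n)
  have "list_drop (Suc n) (list_encode xs) = psnd (list_encode (drop n xs) - 1)"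
    using Suc by (simp add: list_drop_def)
  also have "\<dots> = list_encode (tl (drop n xs))"
    using psnd_encode[of 0 0, unfolded prod_encode_def] by (cases "drop n xs") auto
  finally show ?case by (simp add: drop_Suc tl_drop)
qed (simp add: list_drop_def)

lemma list_nth_encode: "i < length xs \<Longrightarrow> list_nth (list_encode xs) i = xs ! i"
  by (simp add: list_nth_def list_drop_encode Cons_nth_drop_Suc[symmetric])

lemma list_encode_eq_0: "list_encode xs = 0 \<longleftrightarrow> xs = []"
  by (cases xs) auto

lemma list_len_encode: "list_len (list_encode xs) = length xs"
  unfolding list_len_def list_drop_encode list_encode_eq_0
  by (rule Least_equality) auto

lemma computable_list_drop [comp]:
  "computable f \<Longrightarrow> computable g \<Longrightarrow> computable (\<lambda>e. list_drop (f e) (g e))"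
  unfolding list_drop_def by (intro comp)

lemma computable_list_nth [comp]:
  "computable f \<Longrightarrow> computable g \<Longrightarrow> computable (\<lambda>e. list_nth (f e) (g e))"
  unfolding list_nth_def by (intro comp)

lemma computable_list_len [comp]:
  assumes "computable f" shows "computable (\<lambda>e. list_len (f e))"
proof (rule computable_comp[OF _ assms])
  show "computable list_len" unfolding list_len_def
  proof (rule computable_LEAST)
    show "\<exists>n. list_drop n c = 0" for c
      by (metis list_decode_inverse list_drop_encode drop_all order_refl list_encode.simps(1))
  qed (intro comp)
qed

text \<open>Unfolding a definition whose arguments are arbitrary functions of \<open>e\<close> would
  leave these functions under binders, in a larger environment where their computability is not at
  hand. It is enough to treat the case where the arguments are projections and then to
  compose.\<close>

lemma computable_split3:
  assumes "computable (\<lambda>e. f (pfst e) (pfst (psnd e)) (psnd (psnd e)))"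
    "computable a" "computable b" "computable c"
  shows "computable (\<lambda>e. f (a e) (b e) (c e))"
  using computable_comp[OF assms(1), of "\<lambda>e. prod_encode (a e, prod_encode (b e, c e))"] assms(2-)
  by (simp add: comp)

lemma computable_split4:
  assumes "computable (\<lambda>e. f (pfst e) (pfst (psnd e)) (pfst (psnd (psnd e))) (psnd (psnd (psnd e))))"
    "computable a" "computable b" "computable c" "computable d"
  shows "computable (\<lambda>e. f (a e) (b e) (c e) (d e))"
  using computable_comp[OF assms(1), of "\<lambda>e. prod_encode (a e, prod_encode (b e, prod_encode (c e, d e)))"]
    assms(2-) by (simp add: comp)

lemmas decidable_split4 = computable_split4[of "\<lambda>a b c d. of_bool (P a b c d)" for P, folded decidable_def]

lemma total_recursive_2I:
  assumes "computable (\<lambda>e. f (pfst e) (psnd e))"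
  shows "\<exists>F. total_recursive 2 F \<and> (\<forall>x y. F [x, y] = f x y)"
proof -
  have "rec_fun 2 (\<lambda>xs. f (pfst (prod_encode (xs ! 0, xs ! 1))) (psnd (prod_encode (xs ! 0, xs ! 1))))"
    by (rule rec_fun_computable[OF assms]) (intro rec_fun_prod_encode rec_fun_proj; simp)
  then show ?thesis unfolding rec_fun_def by force
qed

section \<open>Cuts and contraction\<close>

text \<open>Count fibre by fibre. A fibre that meets \<open>H\<close> has at least two elements, so
  2 plus its part in \<open>H\<close> is at most twice its size; any other fibre has at least one
  element. This is the bookkeeping for merging components.\<close>

lemma card_image_collisions:
  assumes "finite X" "H \<subseteq> X" and H: "\<And>x. x \<in> H \<Longrightarrow> \<exists>y\<in>X. y \<noteq> x \<and> f y = f x"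
  shows "2 * card (f ` X) + card H \<le> 2 * card X"
proof -
  have finH: "finite H" using assms finite_subset by blast
  have X: "card X = (\<Sum>y\<in>f ` X. card {x \<in> X. f x = y})"
    using assms(1) by (subst card_UN_disjoint[symmetric]) (auto intro!: arg_cong[of _ _ card])
  have "card H = (\<Sum>y\<in>f ` X. card {x \<in> H. f x = y})"
    using assms(1) finH \<open>H \<subseteq> X\<close> by (subst card_UN_disjoint[symmetric]) (auto intro!: arg_cong[of _ _ card])
  then have "2 * card (f ` X) + card H = (\<Sum>y\<in>f ` X. 2 + card {x \<in> H. f x = y})"
    by (simp only: sum.distrib) simp
  also have "\<dots> \<le> (\<Sum>y\<in>f ` X. 2 * card {x \<in> X. f x = y})"
  proof (rule sum_mono)
    fix y assume "y \<in> f ` X"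
    then obtain x where x: "x \<in> X" "f x = y" by blast
    have fin: "finite {x \<in> X. f x = y}" using assms(1) by simp
    show "2 + card {x \<in> H. f x = y} \<le> 2 * card {x \<in> X. f x = y}"
    proof (cases "{x \<in> H. f x = y} = {}")
      case True
      have "card {x \<in> X. f x = y} > 0" using fin x by (auto simp: card_gt_0_iff)
      then show ?thesis unfolding True by simp
    next
      case False
      then obtain z where z: "z \<in> H" "f z = y" by blast
      then obtain z' where z': "z' \<in> X" "z' \<noteq> z" "f z' = y" using H by metis
      have "card {z, z'} \<le> card {x \<in> X. f x = y}"
        using z z' \<open>H \<subseteq> X\<close> by (intro card_mono fin) auto
      moreover have "card {x \<in> H. f x = y} \<le> card {x \<in> X. f x = y}"
        using \<open>H \<subseteq> X\<close> by (intro card_mono fin) auto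
      ultimately show ?thesis using z' by simp
    qed
  qed
  finally show ?thesis by (simp add: X sum_distrib_left)
qed

locale finite_multigraph =
  fixes V :: "'v set" and E :: "'e :: linorder set" and ends :: "'e \<Rightarrow> 'v set"
  assumes multigraph: "multigraph V E ends"
begin

abbreviation \<delta> :: "'v set \<Rightarrow> 'e set" where "\<delta> \<equiv> cut V E ends"

abbreviation \<I> :: "'e set set" where "\<I> \<equiv> cographic_indep V E ends"

lemma finite_E: "finite E" and finite_V: "finite V"
  using multigraph by (auto simp: multigraph_def)

lemma ends_cases:
  assumes "e \<in> E"
  obtains u v where "ends e = {u, v}" "u \<in> V" "v \<in> V"
proof -
  have "ends e \<subseteq> V" "card (ends e) \<in> {1, 2}" using assms multigraph by (auto simp: multigraph_def)
  then show thesis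
    using that by (auto simp: card_1_singleton_iff card_2_iff)
qed

lemma cut_subset: "\<delta> S \<subseteq> E" by (auto simp: cut_def)

lemma mem_cut_iff:
  assumes "e \<in> E" "ends e = {u, v}" "u \<in> V" "v \<in> V"
  shows "e \<in> \<delta> S \<longleftrightarrow> (u \<in> S) \<noteq> (v \<in> S)"
  using assms by (auto simp: cut_def)

lemma mem_cutE:
  assumes "e \<in> \<delta> S"
  obtains u v where "e \<in> E" "ends e = {u, v}" "u \<in> V" "v \<in> V" "u \<in> S" "v \<notin> S"
proof -
  have e: "e \<in> E" using assms cut_subset by auto
  from ends_cases[OF e] obtain u v where uv: "ends e = {u, v}" "u \<in> V" "v \<in> V" .
  then have "(u \<in> S) \<noteq> (v \<in> S)" using mem_cut_iff[OF e] assms by blast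
  then show thesis using that[OF e uv] that[OF e, of v u] uv by (cases "u \<in> S") (auto simp: insert_commute)
qed

text \<open>The boundary map is linear over the field with two elements.\<close>

lemma mem_cut_sym_diff:
  "e \<in> \<delta> ((S - S') \<union> (S' - S)) \<longleftrightarrow> (e \<in> \<delta> S) \<noteq> (e \<in> \<delta> S')"
proof (cases "e \<in> E")
  case True
  from ends_cases[OF this] obtain u v where uv: "ends e = {u, v}" "u \<in> V" "v \<in> V" .
  show ?thesis unfolding mem_cut_iff[OF True uv] by blast
next
  case False
  then show ?thesis by (simp add: cut_def)
qed

lemma cut_complement: "\<delta> (V - S) = \<delta> S"
proof -
  have "e \<in> \<delta> (V - S) \<longleftrightarrow> e \<in> \<delta> S" for e
  proof (cases "e \<in> E")
    case True
    from ends_cases[OF this] obtain u v where uv: "ends e = {u, v}" "u \<in> V" "v \<in> V" .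
    show ?thesis unfolding mem_cut_iff[OF True uv] using uv by blast
  next
    case False
    then show ?thesis by (simp add: cut_def)
  qed
  then show ?thesis by blast
qed

lemma not_indepE:
  assumes "I \<notin> \<I>" "I \<subseteq> E"
  obtains S where "S \<subseteq> V" "\<delta> S \<noteq> {}" "\<delta> S \<subseteq> I"
  using assms by (auto simp: cographic_indep_def)

lemma not_indepI: "S \<subseteq> V \<Longrightarrow> \<delta> S \<noteq> {} \<Longrightarrow> \<delta> S \<subseteq> I \<Longrightarrow> I \<notin> \<I>"
  by (auto simp: cographic_indep_def)

lemma empty_indep: "{} \<in> \<I>"
  by (auto simp: cographic_indep_def)

lemma indep_subset_E: "I \<in> \<I> \<Longrightarrow> I \<subseteq> E"
  by (auto simp: cographic_indep_def)

text \<open>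
  A certificate that \<open>T\<close> is a forest which survives contraction of further edges: no cycle meets a
  cut in exactly one edge.
\<close>

definition cut_separated :: "'e set \<Rightarrow> bool" where
  "cut_separated T \<longleftrightarrow> (\<forall>e\<in>T. \<exists>S\<subseteq>V. \<delta> S \<inter> T = {e})"

text \<open>If the cut of \<open>R\<close>, which certifies \<open>f\<close>, contains the new edge
  \<open>e\<close>, then adding the cut of \<open>S\<close> to it removes \<open>e\<close> and
  changes nothing on \<open>T\<close>.\<close>

lemma cut_separated_insert:
  assumes T: "cut_separated T" and S: "S \<subseteq> V" "e \<in> \<delta> S" "\<delta> S \<inter> T = {}"
  shows "cut_separated (insert e T)"
  unfolding cut_separated_def
proof
  fix f assume "f \<in> insert e T"
  then consider "f = e" | "f \<in> T" "f \<noteq> e" by blast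
  then show "\<exists>S\<subseteq>V. \<delta> S \<inter> insert e T = {f}"
  proof cases
    case 1
    then show ?thesis using S by blast
  next
    case 2
    with T obtain R where R: "R \<subseteq> V" "\<delta> R \<inter> T = {f}" unfolding cut_separated_def by blast
    show ?thesis
    proof (cases "e \<in> \<delta> R")
      case False
      then show ?thesis using R by blast
    next
      case True
      let ?R = "(R - S) \<union> (S - R)"
      have "x \<in> \<delta> ?R \<inter> insert e T \<longleftrightarrow> x = f" for x
        using R S 2 True by (auto simp: mem_cut_sym_diff)
      then have "\<delta> ?R \<inter> insert e T = {f}" by blast
      moreover have "?R \<subseteq> V" using R S by blast
      ultimately show ?thesis by blast
    qed
  qed
qed

text \<open>Insert the edges by increasing label: the cut of which \<open>b\<close> is the minimum
  avoids every edge of \<open>N\<close> inserted before \<open>b\<close>.\<close>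

lemma cut_separated_union:
  assumes "finite N" and T: "cut_separated T"
    and N: "\<And>e. e \<in> N \<Longrightarrow> \<exists>S\<subseteq>V. e \<in> \<delta> S \<and> \<delta> S \<inter> T = {} \<and> (\<forall>x\<in>\<delta> S \<inter> N. e \<le> x)"
  shows "cut_separated (T \<union> N)"
  using assms(1) N
proof (induction N rule: finite_linorder_max_induct)
  case empty
  then show ?case using T by simp
next
  case (insert b A)
  have "cut_separated (T \<union> A)"
  proof (rule insert.IH)
    fix e assume "e \<in> A"
    then have "e \<in> insert b A" by simp
    from insert.prems[OF this]
    show "\<exists>S\<subseteq>V. e \<in> \<delta> S \<and> \<delta> S \<inter> T = {} \<and> (\<forall>x\<in>\<delta> S \<inter> A. e \<le> x)" by blast
  qed
  moreover obtain S where S: "S \<subseteq> V" "b \<in> \<delta> S" "\<delta> S \<inter> T = {}" "\<forall>x\<in>\<delta> S \<inter> insert b A. b \<le> x"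
    using insert.prems[of b] by blast
  then have "\<delta> S \<inter> (T \<union> A) = {}" using insert.hyps(2) by force
  ultimately have "cut_separated (insert b (T \<union> A))" using S by (intro cut_separated_insert)
  then show ?case by simp
qed

text \<open>An edge \<open>e\<close> outside \<open>B\<close> lies in \<open>T\<close>, and its
  certifying cut meets \<open>T\<close> only in \<open>e\<close>. Hence the cut lies in
  \<open>insert e B\<close>, which is therefore dependent.\<close>

lemma basis_if_cut_separated:
  assumes B: "B \<in> \<I>" and T: "cut_separated T" and BT: "B \<union> T = E"
  shows "basis \<I> B"
  unfolding basis_def
proof (intro conjI B ballI impI)
  fix I assume I: "I \<in> \<I>" "B \<subseteq> I"
  show "I = B"
  proof (rule ccontr)
    assume "I \<noteq> B"
    then obtain e where e: "e \<in> I" "e \<notin> B" using I by blast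
    then have "e \<in> T" using BT indep_subset_E[OF I(1)] by blast
    with T obtain S where S: "S \<subseteq> V" "\<delta> S \<inter> T = {e}" unfolding cut_separated_def by blast
    have "\<delta> S \<subseteq> I"
    proof
      fix x assume "x \<in> \<delta> S"
      then have "x \<in> B \<or> x \<in> \<delta> S \<inter> T" using cut_subset[of S] BT by blast
      then show "x \<in> I" using S(2) e I(2) by auto
    qed
    moreover have "\<delta> S \<noteq> {}" using S by blast
    ultimately show False using not_indepI S I by blast
  qed
qed

text \<open>
  The smallest elements of the circuits with at most \<open>k\<close> elements of the minor obtained by
  contracting \<open>B\<close> and deleting \<open>T\<close> in the matroid.
\<close>

definition circuit_minima :: "'e set \<Rightarrow> 'e set \<Rightarrow> nat \<Rightarrow> 'e set" where
  "circuit_minima B T k = {e \<in> E - B - T. \<exists>X\<subseteq>E - B - T. card X < k \<and> (\<forall>x\<in>X. e < x) \<and>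
     B \<union> X \<in> \<I> \<and> insert e (B \<union> X) \<notin> \<I>}"

text \<open>The dependent set \<open>insert e (B \<union> X)\<close> contains a cut. It passes
  through \<open>e\<close>, because \<open>B \<union> X\<close> is independent, and outside
  \<open>B\<close> it has only \<open>e\<close> and larger labels.\<close>

lemma cut_separated_circuit_minima:
  assumes B: "B \<in> \<I>" and T: "cut_separated T" and BT: "B \<inter> T = {}"
  shows "cut_separated (T \<union> circuit_minima B T k)"
proof (rule cut_separated_union[OF _ T])
  show "finite (circuit_minima B T k)" using finite_E by (simp add: circuit_minima_def)
  fix e assume "e \<in> circuit_minima B T k"
  then obtain X where X: "e \<in> E - B - T" "X \<subseteq> E - B - T" "\<forall>x\<in>X. e < x"
    "B \<union> X \<in> \<I>" "insert e (B \<union> X) \<notin> \<I>" unfolding circuit_minima_def by blast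
  have "insert e (B \<union> X) \<subseteq> E" using X indep_subset_E[OF B] by blast
  from not_indepE[OF X(5) this] obtain S where
    S: "S \<subseteq> V" "\<delta> S \<noteq> {}" "\<delta> S \<subseteq> insert e (B \<union> X)" .
  have "e \<in> \<delta> S"
  proof (rule ccontr)
    assume "e \<notin> \<delta> S"
    then have "\<delta> S \<subseteq> B \<union> X" using S by blast
    then show False using not_indepI S X by blast
  qed
  moreover have "\<delta> S \<inter> T = {}" using S(3) X BT by blast
  moreover have "\<forall>x\<in>\<delta> S \<inter> circuit_minima B T k. e \<le> x"
  proof
    fix x assume x: "x \<in> \<delta> S \<inter> circuit_minima B T k"
    then have "x \<notin> B" by (simp add: circuit_minima_def)
    then show "e \<le> x" using x S(3) X(3) by force
  qed
  ultimately show "\<exists>S\<subseteq>V. e \<in> \<delta> S \<and> \<delta> S \<inter> T = {} \<and> (\<forall>x\<in>\<delta> S \<inter> circuit_minima B T k. e \<le> x)"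
    using S by blast
qed

text \<open>Add the elements of the cut outside \<open>B\<close> to \<open>B\<close> by decreasing
  label. The element \<open>e\<close> at which the set first becomes dependent is a circuit minimum,
  with \<open>X\<close> the elements added before it.\<close>

lemma circuit_minima_hit:
  assumes B: "B \<in> \<I>" and S: "S \<subseteq> V" "\<delta> S \<noteq> {}" "\<delta> S \<inter> T = {}" and k: "card (\<delta> S - B) \<le> k"
  shows "\<delta> S \<inter> circuit_minima B T k \<noteq> {}"
proof -
  define D where "D = \<delta> S - B"
  have fin: "finite D" unfolding D_def using finite_subset[OF cut_subset finite_E] by blast
  have DE: "D \<subseteq> E - B - T" using S cut_subset[of S] by (auto simp: D_def)
  have "\<not> \<delta> S \<subseteq> B" using B S not_indepI by blast
  then have "D \<noteq> {}" by (auto simp: D_def)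
  define Q where "Q = {e \<in> D. B \<union> {x \<in> D. e \<le> x} \<notin> \<I>}"
  have "{x \<in> D. Min D \<le> x} = D" using fin by auto
  moreover have "B \<union> D \<notin> \<I>" by (rule not_indepI[OF S(1,2)]) (auto simp: D_def)
  ultimately have "Min D \<in> Q" using \<open>D \<noteq> {}\<close> fin by (simp add: Q_def)
  then have "Q \<noteq> {}" by blast
  have "finite Q" using fin by (simp add: Q_def)
  define e where "e = Max Q"
  have eQ: "e \<in> Q" unfolding e_def using \<open>finite Q\<close> \<open>Q \<noteq> {}\<close> by simp
  then have eD: "e \<in> D" by (simp add: Q_def)
  define X where "X = {x \<in> D. e < x}"
  have "{x \<in> D. e \<le> x} = insert e X" using eD by (auto simp: X_def)
  then have dep: "insert e (B \<union> X) \<notin> \<I>" using eQ by (simp add: Q_def)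
  have ind: "B \<union> X \<in> \<I>"
  proof (cases "X = {}")
    case True
    then show ?thesis using B by simp
  next
    case False
    have finX: "finite X" using fin by (simp add: X_def)
    \<comment> \<open>\<open>y\<close> is the label that follows \<open>e\<close> in
      \<open>D\<close>; it is not in \<open>Q\<close>, because \<open>e\<close> is the largest
      element of \<open>Q\<close>.\<close>
    define y where "y = Min X"
    have y: "y \<in> X" "\<And>x. x \<in> X \<Longrightarrow> y \<le> x" unfolding y_def using finX False by auto
    have "{x \<in> D. y \<le> x} = X" using y by (auto simp: X_def)
    moreover have "y \<notin> Q" using y(1) Max_ge[OF \<open>finite Q\<close>, of y] by (auto simp: X_def e_def)
    ultimately show ?thesis using y(1) by (auto simp: Q_def X_def)
  qed
  have "X \<subset> D" using eD by (auto simp: X_def)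
  then have "card X < card D" by (rule psubset_card_mono[OF fin])
  then have "card X < k" using k by (simp add: D_def)
  then have "e \<in> circuit_minima B T k"
    unfolding circuit_minima_def using eD DE dep ind \<open>X \<subset> D\<close> by (auto simp: X_def intro!: exI[of _ X])
  then show ?thesis using eD by (auto simp: D_def)
qed

text \<open>
  The vertex sets that no edge of \<open>K\<close> leaves form a Boolean algebra, whose atoms are the vertex sets
  of the components of the graph with edge set \<open>K\<close>.
\<close>

definition closed_sets :: "'e set \<Rightarrow> 'v set set" where
  "closed_sets K = {S. S \<subseteq> V \<and> \<delta> S \<inter> K = {}}"

definition block :: "'e set \<Rightarrow> 'v \<Rightarrow> 'v set" where
  "block K u = \<Inter> {S \<in> closed_sets K. u \<in> S}"

text \<open>Blocks that are already whole components of the graph are left out. So the count reaches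
  0 exactly when \<open>K\<close> has the components of the graph, which may itself be
  disconnected.\<close>

definition active_blocks :: "'e set \<Rightarrow> 'v set set" where
  "active_blocks K = {A. \<exists>u\<in>V. A = block K u \<and> \<delta> A \<noteq> {}}"

lemma V_closed: "V \<in> closed_sets K"
  by (auto simp: closed_sets_def cut_def)

lemma closed_complement: "S \<in> closed_sets K \<Longrightarrow> V - S \<in> closed_sets K"
  by (auto simp: closed_sets_def cut_complement)

lemma block_subset: "S \<in> closed_sets K \<Longrightarrow> u \<in> S \<Longrightarrow> block K u \<subseteq> S"
  by (auto simp: block_def)

lemma block_self: "u \<in> block K u"
  by (auto simp: block_def)

lemma block_closed:
  assumes "u \<in> V" shows "block K u \<in> closed_sets K"
proof -
  have "block K u \<subseteq> V" using block_subset[OF V_closed assms] .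
  moreover have "\<delta> (block K u) \<inter> K = {}"
  proof (rule ccontr)
    assume "\<delta> (block K u) \<inter> K \<noteq> {}"
    then obtain e where e: "e \<in> \<delta> (block K u)" "e \<in> K" by blast
    from e(1) obtain x y where xy: "e \<in> E" "ends e = {x, y}" "x \<in> V" "y \<in> V"
      "x \<in> block K u" "y \<notin> block K u" by (rule mem_cutE)
    then obtain S where S: "S \<in> closed_sets K" "u \<in> S" "y \<notin> S" by (auto simp: block_def)
    then have "x \<in> S" using block_subset xy by blast
    then have "e \<in> \<delta> S" using mem_cut_iff xy S by blast
    then show False using S e by (auto simp: closed_sets_def)
  qed
  ultimately show ?thesis by (simp add: closed_sets_def)
qed

text \<open>If \<open>u\<close> were outside the block of \<open>v\<close>, the complement of that
  block would be a closed set that contains \<open>u\<close> but not \<open>v\<close>.\<close>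

lemma block_eq:
  assumes "u \<in> V" "v \<in> block K u" shows "block K v = block K u"
proof
  have v: "v \<in> V" using assms block_closed by (auto simp: closed_sets_def)
  show "block K v \<subseteq> block K u" by (intro block_subset block_closed assms)
  have "u \<in> block K v"
  proof (rule ccontr)
    assume "u \<notin> block K v"
    then have "block K u \<subseteq> V - block K v"
      using assms v by (intro block_subset closed_complement block_closed) auto
    then show False using assms block_self by blast
  qed
  then show "block K u \<subseteq> block K v" by (intro block_subset block_closed v)
qed

lemma closed_sets_antimono: "K \<subseteq> K' \<Longrightarrow> closed_sets K' \<subseteq> closed_sets K"
  by (auto simp: closed_sets_def)

lemma active_blocksI:
  assumes "e \<in> \<delta> (block K u)" "u \<in> V"
  shows "block K u \<in> active_blocks K"
  using assms by (auto simp: active_blocks_def)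

lemma cut_empty_if_no_active_block:
  assumes "active_blocks K = {}" and S: "S \<subseteq> V" "\<delta> S \<inter> K = {}"
  shows "\<delta> S = {}"
proof (rule ccontr)
  assume "\<delta> S \<noteq> {}"
  then obtain e where "e \<in> \<delta> S" by blast
  then obtain u v where uv: "e \<in> E" "ends e = {u, v}" "u \<in> V" "v \<in> V" "u \<in> S" "v \<notin> S"
    by (rule mem_cutE)
  have "block K u \<subseteq> S" using uv S by (intro block_subset) (auto simp: closed_sets_def)
  then have "e \<in> \<delta> (block K u)" using mem_cut_iff[OF uv(1-4)] block_self uv by blast
  then show False using active_blocksI uv assms by blast
qed

lemma active_blocks_subset: "active_blocks K \<subseteq> block K ` (\<Union>e\<in>E. ends e)"
proof
  fix A assume "A \<in> active_blocks K"
  then obtain u e where u: "u \<in> V" "A = block K u" "e \<in> \<delta> A" by (auto simp: active_blocks_def)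
  from u(3) obtain x y where xy: "e \<in> E" "ends e = {x, y}" "x \<in> V" "y \<in> V" "x \<in> A" "y \<notin> A"
    by (rule mem_cutE)
  then have "A = block K x" using block_eq u by blast
  then show "A \<in> block K ` (\<Union>e\<in>E. ends e)" using xy by blast
qed

lemma finite_ends: "finite (\<Union>e\<in>E. ends e)"
  by (rule finite_subset[OF _ finite_V]) (use multigraph in \<open>auto simp: multigraph_def\<close>)

lemma finite_active_blocks: "finite (active_blocks K)"
  by (rule finite_subset[OF active_blocks_subset]) (simp add: finite_ends)

text \<open>An active block contains an endpoint of some edge. The bound has to be in terms of
  edges, since isolated vertices make the size of \<open>V\<close> unrelated to the size of the
  ground set.\<close>

lemma card_active_blocks_le: "card (active_blocks K) \<le> 2 * card E"
proof -
  have "card (active_blocks K) \<le> card (\<Union>e\<in>E. ends e)"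
    using card_mono[OF _ active_blocks_subset] card_image_le finite_ends
    by (meson finite_imageI order_trans)
  also have "\<dots> \<le> (\<Sum>e\<in>E. card (ends e))" by (rule card_UN_le[OF finite_E])
  also have "\<dots> \<le> (\<Sum>e\<in>E. 2)" using multigraph by (intro sum_mono) (auto simp: multigraph_def)
  finally show ?thesis by simp
qed

text \<open>\<open>\<phi>\<close> sends a block of \<open>K\<close> to the block of
  \<open>K \<union> H\<close> around it. A block with an edge of \<open>H\<close> in its boundary
  has the same image as the block across that edge, which is active as well, so the collision count
  applies.\<close>

lemma card_active_blocks_step:
  "2 * card (active_blocks (K \<union> H)) + card {A \<in> active_blocks K. \<delta> A \<inter> H \<noteq> {}}
    \<le> 2 * card (active_blocks K)"
proof -
  let ?K = "K \<union> H"
  define \<phi> where "\<phi> A = \<Inter> {S \<in> closed_sets ?K. A \<subseteq> S}" for A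
  have sub: "block K u \<subseteq> S \<longleftrightarrow> u \<in> S" if "S \<in> closed_sets ?K" for u S
    using that block_self block_subset closed_sets_antimono[of K ?K] by blast
  have \<phi>: "\<phi> (block K u) = block ?K u" for u
    using sub by (auto simp: \<phi>_def block_def[of ?K])
  have "active_blocks ?K \<subseteq> \<phi> ` active_blocks K"
  proof
    fix A assume "A \<in> active_blocks ?K"
    then obtain u e where u: "u \<in> V" "A = block ?K u" "e \<in> \<delta> A" by (auto simp: active_blocks_def)
    from u(3) obtain x y where xy: "e \<in> E" "ends e = {x, y}" "x \<in> V" "y \<in> V" "x \<in> A" "y \<notin> A"
      by (rule mem_cutE)
    have A: "A = block ?K x" using block_eq[OF u(1)] xy u by blast
    have "block K x \<subseteq> A" using sub[OF block_closed[OF u(1)]] u(2) xy by simp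
    then have "e \<in> \<delta> (block K x)" using mem_cut_iff[OF xy(1-4)] block_self xy by blast
    then show "A \<in> \<phi> ` active_blocks K" using active_blocksI xy A \<phi> by (metis image_eqI)
  qed
  then have "card (active_blocks ?K) \<le> card (\<phi> ` active_blocks K)"
    using finite_active_blocks by (intro card_mono) auto
  moreover have "2 * card (\<phi> ` active_blocks K) + card {A \<in> active_blocks K. \<delta> A \<inter> H \<noteq> {}}
    \<le> 2 * card (active_blocks K)"
  proof (rule card_image_collisions[OF finite_active_blocks])
    fix A assume "A \<in> {A \<in> active_blocks K. \<delta> A \<inter> H \<noteq> {}}"
    then obtain u e where u: "u \<in> V" "A = block K u" "e \<in> \<delta> A" "e \<in> H"
      by (auto simp: active_blocks_def)
    from u(3) obtain x y where xy: "e \<in> E" "ends e = {x, y}" "x \<in> V" "y \<in> V" "x \<in> A" "y \<notin> A"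
      by (rule mem_cutE)
    have A: "A = block K x" using block_eq xy u by blast
    have "x \<notin> block K y" using block_eq[of y x K] xy A block_self by blast
    then have "e \<in> \<delta> (block K y)" using mem_cut_iff[OF xy(1-4)] block_self by blast
    then have 1: "block K y \<in> active_blocks K" using active_blocksI xy by blast
    have 2: "block K y \<noteq> A" using block_self xy by blast
    have "e \<notin> \<delta> (block ?K x)" using block_closed[OF xy(3), of ?K] u(4) by (auto simp: closed_sets_def)
    then have "y \<in> block ?K x" using mem_cut_iff[OF xy(1-4)] block_self by blast
    then have "\<phi> (block K y) = \<phi> A" unfolding A \<phi> using block_eq xy by blast
    then show "\<exists>y\<in>active_blocks K. y \<noteq> A \<and> \<phi> y = \<phi> A" using 1 2 by blast
  qed auto
  ultimately show ?thesis by simp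
qed

end

section \<open>Multiplicative hashing\<close>

text \<open>Equal to \<open>(a * x mod (w * t)) div w\<close>: the residues modulo
  \<open>w * t\<close> are cut into \<open>t\<close> intervals of length \<open>w\<close>.\<close>

definition bucket :: "nat \<Rightarrow> nat \<Rightarrow> nat \<Rightarrow> nat \<Rightarrow> nat" where
  "bucket w t a x = (a * x div w) mod t"

text \<open>The two residues lie in one interval of length \<open>w\<close>, so modulo
  \<open>w * t\<close> the product \<open>a * (y - x)\<close> is strictly between \<open>- w\<close>
  and \<open>w\<close>. The shift by \<open>w\<close> keeps this within the natural numbers.\<close>

lemma same_bucket_mod:
  assumes "x < y" "0 < w" and eq: "bucket w t a x = bucket w t a y"
  shows "(a * (y - x) + w) mod (w * t) < 2 * w"
proof -
  define b where "b = bucket w t a x"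
  define M where "M = w * t"
  have x: "a * x mod M = w * b + a * x mod w" and y: "a * y mod M = w * b + a * y mod w"
    unfolding M_def mod_mult2_eq using eq by (simp_all add: b_def bucket_def)
  have "a * x mod w < w" "a * y mod w < w" using assms by simp_all
  then have r: "a * y mod M + w - a * x mod M < 2 * w" "a * x mod M \<le> a * y mod M + w"
    unfolding x y by linarith+
  have "int (a * (y - x) + w) mod int M = (int (a * y) - int (a * x) + int w) mod int M"
    using assms by (simp add: of_nat_diff right_diff_distrib)
  also have "\<dots> = (int (a * y) mod int M - int (a * x) mod int M + int w) mod int M"
    by (metis mod_add_left_eq mod_diff_eq)
  also have "\<dots> = int (a * y mod M + w - a * x mod M) mod int M"
    using r(2) by (simp add: zmod_int of_nat_diff algebra_simps)
  finally have "(a * (y - x) + w) mod M = (a * y mod M + w - a * x mod M) mod M"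
    by (metis of_nat_eq_iff zmod_int)
  also have "\<dots> \<le> a * y mod M + w - a * x mod M" by (rule mod_less_eq_dividend)
  finally show ?thesis using r(1) by (simp add: M_def)
qed

text \<open>As \<open>a\<close> grows by one, \<open>a * d\<close> grows by \<open>d\<close>, so
  \<open>a\<close> is determined by the quotient modulo \<open>M\<close> and the slot of length
  \<open>d\<close> that contains the remainder. There are at most \<open>d + 1\<close> quotients and
  \<open>2 * w div d + 1\<close> slots.\<close>

lemma card_multiples_in_window:
  assumes d: "0 < d" "d < w" and M: "w \<le> M"
  shows "card {a. a < M \<and> (a * d + w) mod M < 2 * w} \<le> 6 * w"
proof -
  let ?A = "{a. a < M \<and> (a * d + w) mod M < 2 * w}"
  define f where "f a = ((a * d + w) div M, ((a * d + w) mod M) div d)" for a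
  have "inj_on f ?A"
  proof (rule inj_onI)
    have *: "a \<le> a'" if "f a = f a'" for a a'
    proof (rule ccontr)
      assume "\<not> a \<le> a'"
      then have "(a' + 1) * d \<le> a * d" by (intro mult_right_mono) auto
      moreover define q where "q = (a * d + w) div M"
      have q: "(a * d + w) div M = q" "(a' * d + w) div M = q" using that by (auto simp: f_def q_def)
      define p where "p = ((a * d + w) mod M) div d"
      have p: "((a * d + w) mod M) div d = p" "((a' * d + w) mod M) div d = p"
        using that by (auto simp: f_def p_def)
      have "a * d + w = q * M + (a * d + w) mod M" "a' * d + w = q * M + (a' * d + w) mod M"
        using q by (metis div_mult_mod_eq)+
      moreover have "(a * d + w) mod M < p * d + d" "p * d \<le> (a' * d + w) mod M"
        using p d by (metis div_mult_mod_eq mod_less_divisor add_less_cancel_left,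
            metis div_times_less_eq_dividend)
      ultimately show False by simp
    qed
    fix a a' assume "f a = f a'"
    then show "a = a'" using *[of a a'] *[of a' a] by simp
  qed
  moreover have "f ` ?A \<subseteq> {..d} \<times> {..2 * w div d}"
  proof
    fix z assume "z \<in> f ` ?A"
    then obtain a where a: "a < M" "(a * d + w) mod M < 2 * w" "z = f a" by blast
    have "(a + 1) * d \<le> M * d" using a by (intro mult_right_mono) auto
    then have "a * d + w < (d + 1) * M" using d M by (simp add: algebra_simps)
    then have "(a * d + w) div M < d + 1" by (rule less_mult_imp_div_less)
    moreover have "((a * d + w) mod M) div d \<le> 2 * w div d" using a by (intro div_le_mono) simp
    ultimately show "z \<in> {..d} \<times> {..2 * w div d}" using a by (simp add: f_def)
  qed
  ultimately have "card ?A \<le> card ({..d} \<times> {..2 * w div d})"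
    by (rule card_inj_on_le) simp
  also have "\<dots> = d * (2 * w div d) + d + 1 + 2 * w div d" by (simp add: algebra_simps)
  also have "\<dots> \<le> 2 * w + w + 2 * w"
  proof -
    have "d * (2 * w div d) \<le> 2 * w" by simp
    moreover have "2 * w div d \<le> 2 * w" by simp
    ultimately show ?thesis using d by linarith
  qed
  finally show ?thesis by simp
qed

lemma card_same_bucket:
  assumes "x < y" "y < w" "0 < t"
  shows "card {a. a < w * t \<and> bucket w t a x = bucket w t a y} \<le> 6 * w"
proof -
  have "card {a. a < w * t \<and> bucket w t a x = bucket w t a y}
      \<le> card {a. a < w * t \<and> (a * (y - x) + w) mod (w * t) < 2 * w}"
    using assms same_bucket_mod by (intro card_mono) auto
  also have "\<dots> \<le> 6 * w" using assms by (intro card_multiples_in_window) auto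
  finally show ?thesis .
qed

text \<open>Each element that shares its value with a smaller one is the upper end of a colliding
  pair.\<close>

lemma card_le_image_plus_pairs:
  fixes D :: "nat set"
  assumes "finite D"
  shows "card D \<le> card (f ` D) + card {(x, y). x \<in> D \<and> y \<in> D \<and> x < y \<and> f x = f y}"
  using assms
proof (induction D rule: finite_linorder_max_induct)
  case (insert b A)
  let ?P = "\<lambda>D. {(x, y). x \<in> D \<and> y \<in> D \<and> x < y \<and> f x = f y}"
  have fin: "finite (?P (insert b A))"
    by (rule finite_subset[of _ "insert b A \<times> insert b A"]) (use insert in auto)
  have b: "b \<notin> A" using insert by blast
  show ?case
  proof (cases "f b \<in> f ` A")
    case True
    then obtain x where x: "x \<in> A" "f x = f b" by auto
    have "insert (x, b) (?P A) \<subseteq> ?P (insert b A)" using x insert by auto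
    then have "card (insert (x, b) (?P A)) \<le> card (?P (insert b A))" by (intro card_mono fin)
    moreover have "(x, b) \<notin> ?P A" using b by blast
    moreover have "finite (?P A)" by (rule finite_subset[OF _ fin]) auto
    ultimately have "Suc (card (?P A)) \<le> card (?P (insert b A))" by simp
    then show ?thesis using insert b True by (simp add: insert_absorb)
  next
    case False
    have "card (?P A) \<le> card (?P (insert b A))" by (intro card_mono fin) auto
    then show ?thesis using insert b False by simp
  qed
qed simp

lemma card_ordered_pairs_le:
  fixes D :: "nat set"
  assumes "finite D"
  shows "2 * card {(x, y). x \<in> D \<and> y \<in> D \<and> x < y} \<le> card D * card D"
proof -
  let ?P = "{(x, y). x \<in> D \<and> y \<in> D \<and> x < y}"
  have fin: "finite ?P" by (rule finite_subset[of _ "D \<times> D"]) (use assms in auto)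
  have "card (prod.swap ` ?P) = card ?P" by (rule card_image) simp
  then have "2 * card ?P = card (?P \<union> prod.swap ` ?P)"
    using fin by (subst card_Un_disjoint) auto
  also have "\<dots> \<le> card (D \<times> D)" using assms by (intro card_mono) auto
  finally show ?thesis by (simp add: card_cartesian_product)
qed

lemma sum_card_Collect_swap:
  assumes "finite A" "finite B"
  shows "(\<Sum>a\<in>A. card {b \<in> B. R a b}) = (\<Sum>b\<in>B. card {a \<in> A. R a b})"
  using sum.swap_restrict[OF assms, of "\<lambda>_ _. 1 :: nat" R] by simp

text \<open>On average at least half as many buckets are hit as \<open>D\<close> has elements. With
  k = \<open>card D\<close> there are at most k * k / 2 pairs, each colliding for at most
  \<open>6 * w\<close> multipliers; \<open>t = 6 * k\<close> makes the total number of collisions at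
  most half of \<open>w * t * k\<close>.\<close>

lemma sum_card_bucket_image:
  assumes D: "D \<subseteq> {..<w}" and k: "0 < card D" and t: "t = 6 * card D"
  shows "w * t * card D \<le> 2 * (\<Sum>a<w * t. card (bucket w t a ` D))"
proof -
  let ?k = "card D"
  define P where "P = {(x, y). x \<in> D \<and> y \<in> D \<and> x < y}"
  define Q where "Q a = {p \<in> P. bucket w t a (fst p) = bucket w t a (snd p)}" for a
  have fin: "finite D" using k card_gt_0_iff by blast
  have finP: "finite P" unfolding P_def by (rule finite_subset[of _ "D \<times> D"]) (use fin in auto)
  have "?k \<le> card (bucket w t a ` D) + card (Q a)" for a
  proof -
    have "Q a = {(x, y). x \<in> D \<and> y \<in> D \<and> x < y \<and> bucket w t a x = bucket w t a y}"
      by (auto simp: Q_def P_def)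
    then show ?thesis using card_le_image_plus_pairs[OF fin, of "bucket w t a"] by simp
  qed
  then have "(\<Sum>a<w * t. ?k) \<le> (\<Sum>a<w * t. card (bucket w t a ` D) + card (Q a))"
    by (intro sum_mono)
  then have 1: "w * t * ?k \<le> (\<Sum>a<w * t. card (bucket w t a ` D)) + (\<Sum>a<w * t. card (Q a))"
    by (simp add: sum.distrib)
  have "(\<Sum>a<w * t. card (Q a))
      = (\<Sum>p\<in>P. card {a \<in> {..<w * t}. bucket w t a (fst p) = bucket w t a (snd p)})"
    unfolding Q_def by (intro sum_card_Collect_swap finP) simp
  also have "\<dots> \<le> (\<Sum>p\<in>P. 6 * w)"
  proof (rule sum_mono)
    fix p assume "p \<in> P"
    then have "fst p < snd p" "snd p < w" using D by (auto simp: P_def)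
    then show "card {a \<in> {..<w * t}. bucket w t a (fst p) = bucket w t a (snd p)} \<le> 6 * w"
      using card_same_bucket[of "fst p" "snd p" w t] k t by simp
  qed
  finally have "2 * (\<Sum>a<w * t. card (Q a)) \<le> 2 * card P * (6 * w)" by (simp add: algebra_simps)
  also have "\<dots> \<le> ?k * ?k * (6 * w)"
    using card_ordered_pairs_le[OF fin] unfolding P_def by (intro mult_right_mono) auto
  also have "\<dots> = w * t * ?k" using t by simp
  finally show ?thesis using 1 by simp
qed

text \<open>One averaging over all pairs of a multiplier and a bucket has to give both many hits and
  a small bucket, so the two demands are merged into one inequality that holds on average.\<close>

lemma good_bucket_exists:
  fixes \<A> :: "'a set" and D :: "'a \<Rightarrow> nat set"
  assumes \<A>: "finite \<A>" "\<A> \<noteq> {}" and E: "E \<subseteq> {..<w}"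
    and D: "\<And>A. A \<in> \<A> \<Longrightarrow> D A \<subseteq> E \<and> card (D A) = k" and k: "0 < k" and t: "t = 6 * k"
  shows "\<exists>a<w * t. \<exists>b<t. card \<A> \<le> 24 * card {A \<in> \<A>. D A \<inter> {x \<in> E. bucket w t a x = b} \<noteq> {}} \<and>
    k * card {x \<in> E. bucket w t a x = b} \<le> 4 * card E"
proof -
  define c where "c = card \<A>"
  define n where "n = card E"
  define h where "h a b = card {A \<in> \<A>. D A \<inter> {x \<in> E. bucket w t a x = b} \<noteq> {}}" for a b
  define s where "s a b = card {x \<in> E. bucket w t a x = b}" for a b
  have t0: "0 < t" using k t by simp
  have finE: "finite E" using E finite_subset by blast
  obtain A0 where A0: "A0 \<in> \<A>" using \<A> by blast
  then have "D A0 \<subseteq> E" "card (D A0) = k" using D by auto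
  then have n0: "0 < n" using k card_mono[OF finE, of "D A0"] by (simp add: n_def)
  have "w \<noteq> 0" using E n0 by (cases "w = 0") (auto simp: n_def)
  have c0: "0 < c" using \<A> by (simp add: c_def card_gt_0_iff)
  have sum_s: "(\<Sum>b<t. s a b) = n" for a
  proof -
    have "(\<Sum>b<t. s a b) = (\<Sum>x\<in>E. card {b \<in> {..<t}. bucket w t a x = b})"
      unfolding s_def by (intro sum_card_Collect_swap finE) simp
    also have "\<dots> = (\<Sum>x\<in>E. 1)"
    proof (rule sum.cong)
      fix x
      have "{b \<in> {..<t}. bucket w t a x = b} = {bucket w t a x}"
        using t0 by (auto simp: bucket_def)
      then show "card {b \<in> {..<t}. bucket w t a x = b} = 1" by simp
    qed simp
    finally show ?thesis by (simp add: n_def)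
  qed
  have sum_h: "(\<Sum>b<t. h a b) = (\<Sum>A\<in>\<A>. card (bucket w t a ` D A))" for a
  proof -
    have "(\<Sum>b<t. h a b) = (\<Sum>A\<in>\<A>. card {b \<in> {..<t}. D A \<inter> {x \<in> E. bucket w t a x = b} \<noteq> {}})"
      unfolding h_def by (intro sum_card_Collect_swap \<A>) simp
    also have "\<dots> = (\<Sum>A\<in>\<A>. card (bucket w t a ` D A))"
    proof (intro sum.cong refl arg_cong[of _ _ card])
      fix A assume "A \<in> \<A>"
      then show "{b \<in> {..<t}. D A \<inter> {x \<in> E. bucket w t a x = b} \<noteq> {}} = bucket w t a ` D A"
        using D t0 by (fastforce simp: bucket_def)
    qed
    finally show ?thesis .
  qed
  have "c * (w * t * k) = (\<Sum>A\<in>\<A>. w * t * k)" by (simp add: c_def)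
  also have "\<dots> \<le> (\<Sum>A\<in>\<A>. 2 * (\<Sum>a<w * t. card (bucket w t a ` D A)))"
  proof (rule sum_mono)
    fix A assume "A \<in> \<A>"
    then have "D A \<subseteq> {..<w}" "card (D A) = k" using D[of A] E by auto
    then show "w * t * k \<le> 2 * (\<Sum>a<w * t. card (bucket w t a ` D A))"
      using sum_card_bucket_image[of "D A" w t] k t by simp
  qed
  also have "\<dots> = 2 * (\<Sum>a<w * t. \<Sum>b<t. h a b)"
    unfolding sum_h by (subst sum.swap) (simp add: sum_distrib_left)
  finally have tot: "c * (w * t * k) \<le> 2 * (\<Sum>a<w * t. \<Sum>b<t. h a b)" .
  \<comment> \<open>On average \<open>h a b\<close> is at least c * k / (2 * t) = c / 12 and
    \<open>s a b\<close> equals n / t, so the left side averages 2 * c * n and the right side at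
    least as much.\<close>
  have "\<exists>a<w * t. \<exists>b<t. c * (n + t * s a b) \<le> 24 * n * h a b"
  proof (rule ccontr)
    assume "\<not> ?thesis"
    then have *: "24 * n * h a b < c * (n + t * s a b)" if "a < w * t" "b < t" for a b
      using that by (meson not_less)
    have "(\<Sum>a<w * t. \<Sum>b<t. 24 * n * h a b) < (\<Sum>a<w * t. \<Sum>b<t. c * (n + t * s a b))"
      using t0 \<open>w \<noteq> 0\<close> by (intro sum_strict_mono) (auto intro!: sum_strict_mono * simp: lessThan_empty_iff)
    also have "\<dots> = (\<Sum>a<w * t. c * (t * n + t * (\<Sum>b<t. s a b)))"
      by (simp add: sum_distrib_left sum.distrib algebra_simps)
    also have "\<dots> = 2 * c * n * t * (w * t)" unfolding sum_s by simp
    also have "\<dots> = 12 * n * (c * (w * t * k))" using t by simp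
    also have "\<dots> \<le> 12 * n * (2 * (\<Sum>a<w * t. \<Sum>b<t. h a b))" using tot by (intro mult_left_mono) auto
    also have "\<dots> = (\<Sum>a<w * t. \<Sum>b<t. 24 * n * h a b)"
      by (simp add: sum_distrib_left mult.assoc)
    finally show False by simp
  qed
  then obtain a b where ab: "a < w * t" "b < t" "c * (n + t * s a b) \<le> 24 * n * h a b" by blast
  \<comment> \<open>Dropping either summand on the left yields one of the two claims; the second one
    also uses \<open>h a b \<le> c\<close>.\<close>
  have "n * c \<le> c * (n + t * s a b)" by (simp add: algebra_simps)
  also have "\<dots> \<le> n * (24 * h a b)" using ab(3) by (simp add: mult.left_commute)
  finally have "n * c \<le> n * (24 * h a b)" .
  then have 1: "c \<le> 24 * h a b" using n0 by simp
  have "h a b \<le> c" unfolding h_def c_def using \<A> by (intro card_mono) auto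
  have "c * (t * s a b) \<le> c * (n + t * s a b)" by simp
  also have "\<dots> \<le> 24 * n * h a b" by (rule ab(3))
  also have "\<dots> \<le> 24 * n * c" using \<open>h a b \<le> c\<close> by simp
  finally have "c * (t * s a b) \<le> c * (24 * n)" by (simp add: mult.commute)
  then have "t * s a b \<le> 24 * n" using c0 by simp
  then have "k * s a b \<le> 4 * n" using t by simp
  then show ?thesis using 1 ab unfolding c_def h_def s_def n_def by blast
qed

section \<open>Sampling\<close>

text \<open>
  The code \<open>d\<close> stands for the pair of a multiplier \<open>d div Suc t\<close> and a bucket \<open>d mod Suc t\<close>; bucket \<open>t\<close>
  does not exist, so \<open>d = t\<close> codes the empty class.
\<close>

definition in_class :: "nat \<Rightarrow> nat \<Rightarrow> nat \<Rightarrow> nat \<Rightarrow> bool" where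
  "in_class w t d x \<longleftrightarrow> bucket w t (d div Suc t) x = d mod Suc t"

lemma in_class_pair: "b \<le> t \<Longrightarrow> in_class w t (a * Suc t + b) x \<longleftrightarrow> bucket w t a x = b"
  by (simp add: in_class_def div_mult_self3 del: mult_Suc_right)

lemma class_code_less: "a < w * t \<Longrightarrow> b \<le> t \<Longrightarrow> a * Suc t + b < w * t * Suc t"
proof -
  assume a: "a < w * t" and b: "b \<le> t"
  have "a * Suc t + b < (a + 1) * Suc t" using b by simp
  also have "\<dots> \<le> w * t * Suc t" using a by (intro mult_right_mono) auto
  finally show ?thesis .
qed

lemma not_in_class: "0 < t \<Longrightarrow> \<not> in_class w t t x"
  by (simp add: in_class_def bucket_def)

locale nat_multigraph = finite_multigraph V E ends
  for V :: "'v set" and E :: "nat set" and ends :: "nat \<Rightarrow> 'v set"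
begin

lemma sampling_step:
  assumes E': "E - B - T \<subseteq> {..<w}" and w: "0 < w" and k: "0 < k" and t: "t = 6 * k"
    and big: "\<And>S. S \<subseteq> V \<Longrightarrow> \<delta> S \<noteq> {} \<Longrightarrow> \<delta> S \<inter> T = {} \<Longrightarrow> k \<le> card (\<delta> S - B)"
    and TK: "T \<subseteq> K"
  shows "\<exists>d<w * t * Suc t. k * card {x \<in> E - B - T. in_class w t d x} \<le> 4 * card (E - B - T) \<and>
    48 * card (active_blocks (K \<union> {x \<in> E - B - T. in_class w t d x})) \<le> 47 * card (active_blocks K)"
proof (cases "active_blocks K = {}")
  case True
  have t0: "0 < t" using k t by simp
  have empty: "{x \<in> E - B - T. in_class w t t x} = {}" using not_in_class[OF t0] by simp
  have "t < w * t * Suc t"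
  proof -
    have "t < 1 * Suc t" by simp
    also have "\<dots> \<le> w * t * Suc t" using w t0 by (intro mult_right_mono) auto
    finally show ?thesis .
  qed
  then show ?thesis using True by (intro exI[of _ t], unfold empty) simp
next
  case False
  \<comment> \<open>The hashing bound is for sets of exactly \<open>k\<close> elements, so each
    boundary is trimmed to that size.\<close>
  have ex: "\<exists>D\<subseteq>\<delta> A - B. D \<subseteq> E - B - T \<and> card D = k" if "A \<in> active_blocks K" for A
  proof -
    from that obtain u where u: "u \<in> V" "A = block K u" "\<delta> A \<noteq> {}" by (auto simp: active_blocks_def)
    then have A: "A \<subseteq> V" "\<delta> A \<inter> K = {}" using block_closed by (auto simp: closed_sets_def)
    then have AT: "\<delta> A \<inter> T = {}" using TK by blast
    then have "k \<le> card (\<delta> A - B)" using big A u by blast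
    then obtain D where "D \<subseteq> \<delta> A - B" "card D = k" by (metis obtain_subset_with_card_n)
    moreover have "\<delta> A - B \<subseteq> E - B - T" using AT cut_subset[of A] by blast
    ultimately show ?thesis by blast
  qed
  then obtain D where D: "\<And>A. A \<in> active_blocks K \<Longrightarrow> D A \<subseteq> \<delta> A - B \<and> D A \<subseteq> E - B - T \<and> card (D A) = k"
    by metis
  from good_bucket_exists[OF finite_active_blocks False E', of D k t] D k t
  obtain a b where ab: "a < w * t" "b < t"
    "card (active_blocks K) \<le>
      24 * card {A \<in> active_blocks K. D A \<inter> {x \<in> E - B - T. bucket w t a x = b} \<noteq> {}}"
    "k * card {x \<in> E - B - T. bucket w t a x = b} \<le> 4 * card (E - B - T)" by blast
  define H where "H = {x \<in> E - B - T. bucket w t a x = b}"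
  have "card {A \<in> active_blocks K. D A \<inter> H \<noteq> {}} \<le> card {A \<in> active_blocks K. \<delta> A \<inter> H \<noteq> {}}"
  proof (rule card_mono)
    have "\<delta> A \<inter> H \<noteq> {}" if "A \<in> active_blocks K" "D A \<inter> H \<noteq> {}" for A
      using D[OF that(1)] that(2) by blast
    then show "{A \<in> active_blocks K. D A \<inter> H \<noteq> {}} \<subseteq> {A \<in> active_blocks K. \<delta> A \<inter> H \<noteq> {}}"
      by blast
  qed (use finite_active_blocks in simp)
  \<comment> \<open>At least 1/24 of the active blocks are hit, and each hit counts one half: 1 -
    1/48 = 47/48.\<close>
  then have "48 * card (active_blocks (K \<union> H)) \<le> 47 * card (active_blocks K)"
    using ab(3) card_active_blocks_step[of K H] unfolding H_def[symmetric] by linarith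
  moreover have "H = {x \<in> E - B - T. in_class w t (a * Suc t + b) x}"
    using in_class_pair[of b t w a] ab(2) by (simp add: H_def)
  moreover have "a * Suc t + b < w * t * Suc t" using class_code_less ab by simp
  ultimately show ?thesis using ab(4) unfolding H_def[symmetric] by auto
qed

lemma sampling:
  assumes E': "E - B - T \<subseteq> {..<w}" and w: "0 < w" and k: "0 < k" and t: "t = 6 * k"
    and big: "\<And>S. S \<subseteq> V \<Longrightarrow> \<delta> S \<noteq> {} \<Longrightarrow> \<delta> S \<inter> T = {} \<Longrightarrow> k \<le> card (\<delta> S - B)"
  shows "\<exists>ds. length ds = n \<and> (\<forall>d\<in>set ds. d < w * t * Suc t) \<and>
    k * card {x \<in> E - B - T. \<exists>d\<in>set ds. in_class w t d x} \<le> 4 * n * card (E - B - T) \<and>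
    48 ^ n * card (active_blocks (T \<union> {x \<in> E - B - T. \<exists>d\<in>set ds. in_class w t d x}))
      \<le> 47 ^ n * card (active_blocks T)"
proof (induction n)
  case 0
  show ?case by simp
next
  case (Suc n)
  then obtain ds where ds: "length ds = n" "\<forall>d\<in>set ds. d < w * t * Suc t"
    "k * card {x \<in> E - B - T. \<exists>d\<in>set ds. in_class w t d x} \<le> 4 * n * card (E - B - T)"
    "48 ^ n * card (active_blocks (T \<union> {x \<in> E - B - T. \<exists>d\<in>set ds. in_class w t d x}))
      \<le> 47 ^ n * card (active_blocks T)" by blast
  define K where "K = {x \<in> E - B - T. \<exists>d\<in>set ds. in_class w t d x}"
  have "T \<subseteq> T \<union> K" by blast
  from sampling_step[OF E' w k t big this] obtain d where d: "d < w * t * Suc t"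
    "k * card {x \<in> E - B - T. in_class w t d x} \<le> 4 * card (E - B - T)"
    "48 * card (active_blocks (T \<union> K \<union> {x \<in> E - B - T. in_class w t d x}))
      \<le> 47 * card (active_blocks (T \<union> K))" by blast
  define H where "H = {x \<in> E - B - T. in_class w t d x}"
  have KH: "{x \<in> E - B - T. \<exists>d\<in>set (d # ds). in_class w t d x} = K \<union> H"
    by (auto simp: K_def H_def)
  have "k * card (K \<union> H) \<le> k * (card K + card H)" by (intro mult_left_mono card_Un_le) simp
  also have "\<dots> \<le> 4 * Suc n * card (E - B - T)"
    using ds(3) d(2) unfolding K_def[symmetric] H_def[symmetric] by (simp add: algebra_simps)
  finally have 1: "k * card (K \<union> H) \<le> 4 * Suc n * card (E - B - T)" .
  have "48 ^ Suc n * card (active_blocks (T \<union> (K \<union> H))) = 48 ^ n * (48 * card (active_blocks (T \<union> K \<union> H)))"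
    by (simp add: Un_assoc)
  also have "\<dots> \<le> 48 ^ n * (47 * card (active_blocks (T \<union> K)))"
    using d(3) unfolding H_def[symmetric] by (intro mult_left_mono) auto
  also have "\<dots> = 47 * (48 ^ n * card (active_blocks (T \<union> K)))" by simp
  also have "\<dots> \<le> 47 * (47 ^ n * card (active_blocks T))"
    using ds(4) unfolding K_def[symmetric] by (intro mult_left_mono) auto
  finally have 2: "48 ^ Suc n * card (active_blocks (T \<union> (K \<union> H))) \<le> 47 ^ Suc n * card (active_blocks T)"
    by simp
  show ?case
    by (rule exI[of _ "d # ds"], unfold KH) (use ds(1,2) d(1) 1 2 in simp)
qed

text \<open>\<open>L\<close> classes each hold at most a fraction 4 / k of the free edges, so
  \<open>k = 8 * L\<close> keeps the sample within one half. \<open>L\<close> is large enough to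
  bring the number of active blocks below 1, and then no nonempty cut avoids \<open>T\<close> and
  the sample.\<close>

lemma indep_complement_sample:
  assumes E: "E \<subseteq> {..<2 ^ l}" "card E < 2 ^ l" and L: "L = 40 * Suc l" and k: "k = 8 * L"
    and t: "t = 6 * k" and B: "B \<in> \<I>" and BT: "B \<inter> T = {}"
    and big: "\<And>S. S \<subseteq> V \<Longrightarrow> \<delta> S \<noteq> {} \<Longrightarrow> \<delta> S \<inter> T = {} \<Longrightarrow> k \<le> card (\<delta> S - B)"
  shows "\<exists>ds. length ds = L \<and> (\<forall>d\<in>set ds. d < 2 ^ l * t * Suc t) \<and>
    2 * card {x \<in> E - B - T. \<exists>d\<in>set ds. in_class (2 ^ l) t d x} \<le> card (E - B - T) \<and>
    B \<union> (E - B - T - {x \<in> E - B - T. \<exists>d\<in>set ds. in_class (2 ^ l) t d x}) \<in> \<I>"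
proof -
  have E': "E - B - T \<subseteq> {..<2 ^ l}" using E by blast
  have k0: "0 < k" using k L by simp
  have w0: "0 < (2 :: nat) ^ l" by simp
  from sampling[OF E' w0 k0 t big, of L] obtain ds where ds: "length ds = L"
    "\<forall>d\<in>set ds. d < 2 ^ l * t * Suc t"
    "k * card {x \<in> E - B - T. \<exists>d\<in>set ds. in_class (2 ^ l) t d x} \<le> 4 * L * card (E - B - T)"
    "48 ^ L * card (active_blocks (T \<union> {x \<in> E - B - T. \<exists>d\<in>set ds. in_class (2 ^ l) t d x}))
      \<le> 47 ^ L * card (active_blocks T)" by blast
  define K where "K = {x \<in> E - B - T. \<exists>d\<in>set ds. in_class (2 ^ l) t d x}"
  have "4 * L * (2 * card K) \<le> 4 * L * card (E - B - T)"
    using ds(3) unfolding K_def[symmetric] k by simp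
  then have half: "2 * card K \<le> card (E - B - T)" using L by simp
  have "card (active_blocks (T \<union> K)) = 0"
  proof (rule ccontr)
    assume "card (active_blocks (T \<union> K)) \<noteq> 0"
    then have "48 ^ L * 1 \<le> 48 ^ L * card (active_blocks (T \<union> K))" by (intro mult_left_mono) auto
    also have "\<dots> \<le> 47 ^ L * card (active_blocks T)" using ds(4) unfolding K_def .
    also have "\<dots> \<le> 47 ^ L * (2 * card E)" by (intro mult_left_mono card_active_blocks_le) simp
    also have "\<dots> < 47 ^ L * (2 * 2 ^ l)" using E(2) by (intro mult_strict_left_mono) auto
    \<comment> \<open>The 40 in \<open>L\<close> is chosen so that
      \<open>2 * 47 ^ 40 \<le> 48 ^ 40\<close>: forty classes more than halve the count, and fewer
      than 2 ^ (l + 1) blocks are active at the start.\<close>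
    also have "\<dots> = (2 * 47 ^ 40) ^ Suc l"
      unfolding L power_mult power_mult_distrib by (simp only: power_Suc[of 2, symmetric] mult.commute)
    also have "\<dots> \<le> (48 ^ 40) ^ Suc l" by (intro power_mono) simp_all
    finally show False by (simp only: L power_mult mult_1_right less_irrefl)
  qed
  then have empty: "active_blocks (T \<union> K) = {}" using finite_active_blocks by simp
  have "B \<union> (E - B - T - K) \<in> \<I>"
  proof (rule ccontr)
    assume "B \<union> (E - B - T - K) \<notin> \<I>"
    moreover have "B \<union> (E - B - T - K) \<subseteq> E" using indep_subset_E[OF B] by blast
    ultimately obtain S where S: "S \<subseteq> V" "\<delta> S \<noteq> {}" "\<delta> S \<subseteq> B \<union> (E - B - T - K)"
      by (rule not_indepE)
    then have "\<delta> S \<inter> (T \<union> K) = {}" using BT by (auto simp: K_def)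
    then show False using cut_empty_if_no_active_block[OF empty S(1)] S(2) by blast
  qed
  then show ?thesis using ds(1,2) half unfolding K_def by blast
qed

end

section \<open>The algorithm\<close>

definition bitlen :: "nat \<Rightarrow> nat" where "bitlen m = (LEAST l. m < 2 ^ l)"

text \<open>320 = 8 * 40, for samples of \<open>40 * Suc (bitlen m)\<close> classes, as in
  \<open>indep_complement_sample\<close>.\<close>

definition threshold :: "nat \<Rightarrow> nat" where "threshold m = 320 * Suc (bitlen m)"

definition buckets :: "nat \<Rightarrow> nat" where "buckets m = 6 * threshold m"

text \<open>The number of codes of hash classes. It exceeds \<open>m\<close>, so one digit can also
  name an edge, and both kinds of round share the same range of query numbers.\<close>

definition digit_base :: "nat \<Rightarrow> nat" where
  "digit_base m = 2 ^ bitlen m * buckets m * Suc (buckets m)"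

definition num_queries :: "nat \<Rightarrow> nat" where "num_queries m = digit_base m ^ threshold m"

definition num_rounds :: "nat \<Rightarrow> nat" where "num_rounds m = 2 * Suc (bitlen m)"

definition digit :: "nat \<Rightarrow> nat \<Rightarrow> nat \<Rightarrow> nat" where "digit n c i = c div n ^ i mod n"

text \<open>
  A state is the code of a pair of set codes: the edges deleted from the graph so far, which belong
  to the basis, and the edges contracted so far, which belong to the spanning forest.
\<close>

definition free :: "nat \<Rightarrow> nat \<Rightarrow> nat \<Rightarrow> bool" where
  "free m s x \<longleftrightarrow> x < m \<and> x \<notin> set_decode (pfst s) \<and> x \<notin> set_decode (psnd s)"

definition in_tuple :: "nat \<Rightarrow> nat \<Rightarrow> nat \<Rightarrow> nat \<Rightarrow> bool" where
  "in_tuple m s c x \<longleftrightarrow> free m s x \<and> (\<exists>i<threshold m. digit (digit_base m) c i = x)"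

definition in_sample :: "nat \<Rightarrow> nat \<Rightarrow> nat \<Rightarrow> nat \<Rightarrow> bool" where
  "in_sample m s c x \<longleftrightarrow> free m s x \<and>
     (\<exists>i<threshold m. in_class (2 ^ bitlen m) (buckets m) (digit (digit_base m) c i) x)"

text \<open>Every query contains the deleted edges, so that the oracle answers for the minor in
  which these are contracted in the matroid.\<close>

definition query :: "nat \<Rightarrow> nat \<Rightarrow> nat \<Rightarrow> nat \<Rightarrow> nat" where
  "query m s r c = set_encode {x. x < m \<and> (x \<in> set_decode (pfst s) \<or>
     r mod 2 = 0 \<and> in_tuple m s c x \<or> r mod 2 = 1 \<and> free m s x \<and> \<not> in_sample m s c x)}"

text \<open>The circuit minima read off the answers alone: \<open>c\<close> codes the independent
  set \<open>X\<close> and \<open>c'\<close> codes the dependent set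
  \<open>insert e X\<close>.\<close>

definition contract :: "nat \<Rightarrow> nat \<Rightarrow> nat \<Rightarrow> nat" where
  "contract m s a = set_encode {e. e < m \<and> (e \<in> set_decode (psnd s) \<or> free m s e \<and>
     (\<exists>c<num_queries m. \<exists>c'<num_queries m. list_nth a c = 1 \<and> list_nth a c' = 0 \<and>
        (\<forall>x<m. in_tuple m s c x \<longrightarrow> e < x) \<and>
        (\<forall>x<m. in_tuple m s c' x \<longleftrightarrow> x = e \<or> in_tuple m s c x)))}"

text \<open>
  The first disjunct only makes the search total; \<open>invariant_next_odd\<close> shows that it is not reached.
\<close>

definition sample_choice :: "nat \<Rightarrow> nat \<Rightarrow> nat \<Rightarrow> nat" where
  "sample_choice m s a = (LEAST c. c = num_queries m \<or> list_nth a c = 1 \<and>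
     2 * card {x. x < m \<and> in_sample m s c x} \<le> card {x. x < m \<and> free m s x})"

text \<open>In an odd round the new set of deleted edges is the accepted query itself.\<close>

definition next_state :: "nat \<Rightarrow> nat \<Rightarrow> nat \<Rightarrow> nat \<Rightarrow> nat" where
  "next_state m r s a = (if r mod 2 = 0 then prod_encode (pfst s, contract m s a)
     else prod_encode (query m s 1 (sample_choice m s a), psnd s))"

text \<open>An algorithm has no memory besides the transcript, so the current state is recomputed
  from the full history \<open>h\<close>.\<close>

definition state :: "nat \<Rightarrow> nat \<Rightarrow> nat \<Rightarrow> nat" where
  "state m h r = rec_nat (prod_encode (0, 0)) (\<lambda>r s. next_state m r s (list_nth h r)) r"

text \<open>Even and odd numbers are the codes of the left and right injections of
  \<open>sum_decode\<close>.\<close>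

definition action_code :: "nat \<Rightarrow> nat \<Rightarrow> nat" where
  "action_code m h = (let r = list_len h; s = state m h r in
     if r < num_rounds m then 2 * list_encode (map (\<lambda>c. query m s r c) [0..<num_queries m])
     else Suc (2 * pfst s))"

definition basis_algorithm :: algorithm where
  "basis_algorithm m h = action_decode (action_code m (answers_encode h))"

section \<open>Computability of the algorithm\<close>

lemma less_two_power_bitlen: "m < 2 ^ bitlen m"
  unfolding bitlen_def by (rule LeastI[of _ m]) (rule less_exp)

lemma computable_bitlen [comp]: "computable f \<Longrightarrow> computable (\<lambda>e. bitlen (f e))"
proof (rule computable_comp[of bitlen])
  show "computable bitlen" unfolding bitlen_def
    by (rule computable_LEAST, intro comp, rule exI, rule less_exp)
qed

lemma computable_threshold [comp]: "computable f \<Longrightarrow> computable (\<lambda>e. threshold (f e))"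
  unfolding threshold_def by (intro comp)

lemma computable_buckets [comp]: "computable f \<Longrightarrow> computable (\<lambda>e. buckets (f e))"
  unfolding buckets_def by (intro comp)

lemma computable_digit_base [comp]: "computable f \<Longrightarrow> computable (\<lambda>e. digit_base (f e))"
  unfolding digit_base_def by (intro comp)

lemma computable_num_queries [comp]: "computable f \<Longrightarrow> computable (\<lambda>e. num_queries (f e))"
  unfolding num_queries_def by (intro comp)

lemma computable_num_rounds [comp]: "computable f \<Longrightarrow> computable (\<lambda>e. num_rounds (f e))"
  unfolding num_rounds_def by (intro comp)

lemma computable_digit [comp]:
  "computable n \<Longrightarrow> computable c \<Longrightarrow> computable i \<Longrightarrow> computable (\<lambda>e. digit (n e) (c e) (i e))"
  unfolding digit_def by (intro comp)

lemma decidable_free [comp]: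
  "computable m \<Longrightarrow> computable s \<Longrightarrow> computable x \<Longrightarrow> decidable (\<lambda>e. free (m e) (s e) (x e))"
  unfolding free_def by (intro comp)

lemma decidable_in_class [comp]:
  "computable w \<Longrightarrow> computable t \<Longrightarrow> computable d \<Longrightarrow> computable x \<Longrightarrow>
    decidable (\<lambda>e. in_class (w e) (t e) (d e) (x e))"
  unfolding in_class_def bucket_def by (intro comp)

lemma decidable_in_tuple [comp]:
  "computable m \<Longrightarrow> computable s \<Longrightarrow> computable c \<Longrightarrow> computable x \<Longrightarrow>
    decidable (\<lambda>e. in_tuple (m e) (s e) (c e) (x e))"
  by (rule decidable_split4; assumption?) (unfold in_tuple_def, intro comp)

lemma decidable_in_sample [comp]:
  "computable m \<Longrightarrow> computable s \<Longrightarrow> computable c \<Longrightarrow> computable x \<Longrightarrow>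
    decidable (\<lambda>e. in_sample (m e) (s e) (c e) (x e))"
  by (rule decidable_split4; assumption?) (unfold in_sample_def, intro comp)

lemma computable_query [comp]:
  "computable m \<Longrightarrow> computable s \<Longrightarrow> computable r \<Longrightarrow> computable c \<Longrightarrow>
    computable (\<lambda>e. query (m e) (s e) (r e) (c e))"
  by (rule computable_split4; assumption?) (unfold query_def, intro comp)

lemma computable_contract [comp]:
  "computable m \<Longrightarrow> computable s \<Longrightarrow> computable a \<Longrightarrow> computable (\<lambda>e. contract (m e) (s e) (a e))"
  by (rule computable_split3; assumption?) (unfold contract_def, intro comp)

lemma computable_sample_choice [comp]:
  "computable m \<Longrightarrow> computable s \<Longrightarrow> computable a \<Longrightarrow> computable (\<lambda>e. sample_choice (m e) (s e) (a e))"
  by (rule computable_split3; assumption?)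
    (unfold sample_choice_def, rule computable_LEAST, intro comp, blast)

lemma computable_next_state [comp]:
  "computable m \<Longrightarrow> computable r \<Longrightarrow> computable s \<Longrightarrow> computable a \<Longrightarrow>
    computable (\<lambda>e. next_state (m e) (r e) (s e) (a e))"
  unfolding next_state_def by (intro comp)

lemma computable_state [comp]:
  "computable m \<Longrightarrow> computable h \<Longrightarrow> computable r \<Longrightarrow> computable (\<lambda>e. state (m e) (h e) (r e))"
  by (rule computable_split3; assumption?) (unfold state_def, intro comp)

lemma uniform_basis_algorithm: "uniform_algorithm basis_algorithm"
proof -
  have "computable (\<lambda>e. action_code (pfst e) (psnd e))"
    unfolding action_code_def Let_def by (intro comp)
  from total_recursive_2I[OF this] show ?thesis
    unfolding uniform_algorithm_def basis_algorithm_def by metis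
qed

section \<open>Digit expansions that code small edge sets and samples\<close>

lemma digits_exist:
  assumes "\<forall>d\<in>set ds. d < n"
  shows "\<exists>c<n ^ length ds. \<forall>i<length ds. digit n c i = ds ! i"
  using assms
proof (induction ds)
  case (Cons d ds)
  then obtain c where c: "c < n ^ length ds" "\<forall>i<length ds. digit n c i = ds ! i" by auto
  have d: "d < n" using Cons by simp
  have "d + n * c < n * (c + 1)" using d by simp
  also have "\<dots> \<le> n * n ^ length ds" using c by (intro mult_left_mono) auto
  finally have "d + n * c < n ^ length (d # ds)" by simp
  moreover have "digit n (d + n * c) i = (d # ds) ! i" if "i < length (d # ds)" for i
  proof (cases i)
    case 0
    then show ?thesis using d by (simp add: digit_def)
  next
    case (Suc j)
    then show ?thesis using d c that by (simp add: digit_def div_mult2_eq)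
  qed
  ultimately show ?case by blast
qed simp

lemma digits_exist_padded:
  assumes "\<forall>d\<in>set ds. d < n" "z < n" "length ds \<le> k"
  shows "\<exists>c<n ^ k. {digit n c i |i. i < k} \<subseteq> insert z (set ds) \<and> set ds \<subseteq> {digit n c i |i. i < k}"
proof -
  let ?ds = "ds @ replicate (k - length ds) z"
  have "\<forall>d\<in>set ?ds. d < n" using assms by auto
  from digits_exist[OF this] obtain c where
    c: "c < n ^ k" "\<forall>i<k. digit n c i = ?ds ! i" using assms(3) by auto
  have "{digit n c i |i. i < k} = {?ds ! i |i. i < k}"
    using c(2) by (intro Collect_cong ex_cong1) auto
  also have "\<dots> = set ?ds" unfolding set_conv_nth using assms(3) by simp
  finally have eq: "{digit n c i |i. i < k} = set ?ds" .
  show ?thesis by (intro exI[of _ c] conjI c(1); unfold eq) auto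
qed

lemma set_decode_query:
  "set_decode (query m s r c) = {x. x < m \<and> (x \<in> set_decode (pfst s) \<or>
     r mod 2 = 0 \<and> in_tuple m s c x \<or> r mod 2 = 1 \<and> free m s x \<and> \<not> in_sample m s c x)}"
  unfolding query_def by (rule set_encode_inverse) simp

lemma set_decode_contract:
  "set_decode (contract m s a) = {e. e < m \<and> (e \<in> set_decode (psnd s) \<or> free m s e \<and>
     (\<exists>c<num_queries m. \<exists>c'<num_queries m. list_nth a c = 1 \<and> list_nth a c' = 0 \<and>
        (\<forall>x<m. in_tuple m s c x \<longrightarrow> e < x) \<and>
        (\<forall>x<m. in_tuple m s c' x \<longleftrightarrow> x = e \<or> in_tuple m s c x)))}"
  unfolding contract_def by (rule set_encode_inverse) simp

lemma buckets_pos: "0 < buckets m"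
  by (simp add: threshold_def buckets_def)

lemma digit_base_gt: "m < digit_base m" "buckets m < digit_base m"
proof -
  have "m < 2 ^ bitlen m * 1 * 1" using less_two_power_bitlen[of m] by simp
  also have "\<dots> \<le> digit_base m" unfolding digit_base_def using buckets_pos[of m] by (intro mult_le_mono) auto
  finally show "m < digit_base m" .
  have "buckets m < 1 * 1 * Suc (buckets m)" by simp
  also have "\<dots> \<le> digit_base m" unfolding digit_base_def using buckets_pos[of m] by (intro mult_le_mono) auto
  finally show "buckets m < digit_base m" .
qed

lemma in_tuple_surj:
  assumes X: "X \<subseteq> {x. free m s x}" and card: "card X \<le> threshold m"
  shows "\<exists>c<num_queries m. {x. in_tuple m s c x} = X"
proof -
  have Xm: "X \<subseteq> {..<m}" using X by (auto simp: free_def)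
  then have "finite X" using finite_subset by blast
  then obtain xs where xs: "set xs = X" "length xs = card X"
    using finite_distinct_list distinct_card by metis
  have "\<forall>d\<in>set xs. d < digit_base m" using Xm xs digit_base_gt(1)[of m] by fastforce
  \<comment> \<open>Surplus digits are filled with \<open>m\<close>, which is not an edge and so
    never free.\<close>
  from digits_exist_padded[OF this digit_base_gt(1), of "threshold m"] obtain c where
    c: "c < num_queries m" "{digit (digit_base m) c i |i. i < threshold m} \<subseteq> insert m X"
    "X \<subseteq> {digit (digit_base m) c i |i. i < threshold m}"
    using xs card unfolding num_queries_def by auto
  have "{x. in_tuple m s c x} = {x. free m s x} \<inter> {digit (digit_base m) c i |i. i < threshold m}"
    by (auto simp: in_tuple_def)
  also have "\<dots> = X" using c X by (auto simp: free_def)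
  finally show ?thesis using c(1) by blast
qed

lemma card_in_tuple_le: "card {x. in_tuple m s c x} \<le> threshold m"
proof -
  have "{x. in_tuple m s c x} \<subseteq> digit (digit_base m) c ` {..<threshold m}"
    by (auto simp: in_tuple_def)
  then have "card {x. in_tuple m s c x} \<le> card (digit (digit_base m) c ` {..<threshold m})"
    by (intro card_mono) auto
  also have "\<dots> \<le> threshold m" using card_image_le[of "{..<threshold m}"] by fastforce
  finally show ?thesis .
qed

lemma in_sample_surj:
  assumes ds: "\<forall>d\<in>set ds. d < digit_base m" "length ds \<le> threshold m"
  shows "\<exists>c<num_queries m. \<forall>x. in_sample m s c x \<longleftrightarrow>
    free m s x \<and> (\<exists>d\<in>set ds. in_class (2 ^ bitlen m) (buckets m) d x)"
proof -
  let ?I = "in_class (2 ^ bitlen m) (buckets m)"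
  \<comment> \<open>Surplus digits are filled with the code of the empty class.\<close>
  from digits_exist_padded[OF ds(1) digit_base_gt(2) ds(2)] obtain c where
    c: "c < num_queries m" "{digit (digit_base m) c i |i. i < threshold m} \<subseteq> insert (buckets m) (set ds)"
    "set ds \<subseteq> {digit (digit_base m) c i |i. i < threshold m}"
    unfolding num_queries_def by auto
  have bex: "(\<exists>d\<in>D. P d) \<longleftrightarrow> (\<exists>d\<in>S. P d)" if "D \<subseteq> insert z S" "S \<subseteq> D" "\<not> P z"
    for D S and z :: nat and P
    using that by blast
  have "in_sample m s c x \<longleftrightarrow> free m s x \<and> (\<exists>d\<in>set ds. ?I d x)" for x
  proof -
    have "in_sample m s c x \<longleftrightarrow>
        free m s x \<and> (\<exists>d\<in>{digit (digit_base m) c i |i. i < threshold m}. ?I d x)"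
      by (auto simp: in_sample_def)
    also have "\<dots> \<longleftrightarrow> free m s x \<and> (\<exists>d\<in>set ds. ?I d x)"
      using bex[OF c(2,3), of "\<lambda>d. ?I d x"] not_in_class[OF buckets_pos, of "2 ^ bitlen m" m x] by simp
    finally show ?thesis .
  qed
  then show ?thesis using c(1) by blast
qed

section \<open>Correctness of the run\<close>

locale cographic_oracle = nat_multigraph V "{..<m}" ends
  for V :: "'v set" and m :: nat and ends :: "nat \<Rightarrow> 'v set"
begin

abbreviation deleted :: "nat \<Rightarrow> nat set" where "deleted s \<equiv> set_decode (pfst s)"

abbreviation contracted :: "nat \<Rightarrow> nat set" where "contracted s \<equiv> set_decode (psnd s)"

definition answers :: "nat \<Rightarrow> nat \<Rightarrow> nat" where
  "answers r s = list_encode (map (\<lambda>c. of_bool (set_decode (query m s r c) \<in> \<I>)) [0..<num_queries m])"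

text \<open>The intended sequence of states, defined from the oracle without a transcript;
  \<open>state_batches\<close> identifies it with the replay.\<close>

primrec run :: "nat \<Rightarrow> nat" where
  "run 0 = prod_encode (0, 0)"
| "run (Suc r) = next_state m r (run r) (answers r (run r))"

lemma free_set: "{x. free m s x} = {..<m} - deleted s - contracted s"
  by (auto simp: free_def)

lemma answers_nth:
  "c < num_queries m \<Longrightarrow> list_nth (answers r s) c = of_bool (set_decode (query m s r c) \<in> \<I>)"
  unfolding answers_def by (subst list_nth_encode) auto

text \<open>Once no edge is free, these are the hypotheses of
  \<open>basis_if_cut_separated\<close>.\<close>

definition invariant :: "nat \<Rightarrow> bool" where
  "invariant s \<longleftrightarrow> deleted s \<in> \<I> \<and> contracted s \<subseteq> {..<m} \<and> deleted s \<inter> contracted s = {} \<and>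
     cut_separated (contracted s)"

lemma set_decode_query_even:
  assumes "invariant s" "r mod 2 = 0"
  shows "set_decode (query m s r c) = deleted s \<union> {x. in_tuple m s c x}"
  using assms indep_subset_E[of "deleted s"] unfolding set_decode_query invariant_def
  by (auto simp: in_tuple_def free_def)

lemma set_decode_query_odd:
  assumes "invariant s" "r mod 2 = 1"
  shows "set_decode (query m s r c) = deleted s \<union> ({x. free m s x} - {x. in_sample m s c x})"
  using assms indep_subset_E[of "deleted s"] unfolding set_decode_query invariant_def
  by (auto simp: free_def)

text \<open>A tuple codes exactly the sets of at most \<open>threshold m\<close> free edges. The
  strict bound in \<open>circuit_minima\<close> matches this: \<open>insert e X\<close> must still
  fit into a tuple, and conversely \<open>e\<close> is not in \<open>X\<close>, so \<open>X\<close>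
  is strictly smaller than the coded set.\<close>

lemma contracted_next_even:
  assumes inv: "invariant s" and r: "r mod 2 = 0"
  shows "contracted (next_state m r s (answers r s))
    = contracted s \<union> circuit_minima (deleted s) (contracted s) (threshold m)"
proof -
  let ?X = "\<lambda>c. {x. in_tuple m s c x}"
  have q: "list_nth (answers r s) c = of_bool (deleted s \<union> ?X c \<in> \<I>)" if "c < num_queries m" for c
    unfolding answers_nth[OF that] set_decode_query_even[OF assms] by (rule refl)
  have q1: "list_nth (answers r s) c = 1 \<longleftrightarrow> deleted s \<union> ?X c \<in> \<I>" if "c < num_queries m" for c
    unfolding q[OF that] by (rule of_bool_eq_1_iff)
  have q0: "list_nth (answers r s) c = 0 \<longleftrightarrow> deleted s \<union> ?X c \<notin> \<I>" if "c < num_queries m" for c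
    unfolding q[OF that] by (rule of_bool_eq_0_iff)
  have Xm: "in_tuple m s c x \<Longrightarrow> x < m" for c x by (simp add: in_tuple_def free_def)
  have fin: "finite (?X c)" for c by (rule finite_subset[of _ "{..<m}"]) (use Xm in auto)
  have iff: "(\<exists>c<num_queries m. \<exists>c'<num_queries m. list_nth (answers r s) c = 1 \<and>
        list_nth (answers r s) c' = 0 \<and> (\<forall>x<m. in_tuple m s c x \<longrightarrow> e < x) \<and>
        (\<forall>x<m. in_tuple m s c' x \<longleftrightarrow> x = e \<or> in_tuple m s c x)) \<longleftrightarrow>
      (\<exists>X\<subseteq>{x. free m s x}. card X < threshold m \<and> (\<forall>x\<in>X. e < x) \<and>
        deleted s \<union> X \<in> \<I> \<and> insert e (deleted s \<union> X) \<notin> \<I>)" (is "?L \<longleftrightarrow> ?R")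
    if e: "free m s e" for e
  proof
    assume ?L
    then obtain c c' where c: "c < num_queries m" "c' < num_queries m"
      "list_nth (answers r s) c = 1" "list_nth (answers r s) c' = 0"
      "\<forall>x<m. in_tuple m s c x \<longrightarrow> e < x" "\<forall>x<m. in_tuple m s c' x \<longleftrightarrow> x = e \<or> in_tuple m s c x"
      by blast
    have X': "?X c' = insert e (?X c)" using c(6) Xm e by (auto simp: free_def)
    have "e \<notin> ?X c" using c(5) Xm by blast
    then have "card (?X c) < card (?X c')" unfolding X' using fin by simp
    then have "card (?X c) < threshold m" using card_in_tuple_le order.strict_trans2 by blast
    moreover have "deleted s \<union> ?X c \<in> \<I>" using c(3) unfolding q1[OF c(1)] .
    moreover have "insert e (deleted s \<union> ?X c) \<notin> \<I>"
      using c(4) unfolding q0[OF c(2)] X' Un_insert_right .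
    moreover have "?X c \<subseteq> {x. free m s x}" by (auto simp: in_tuple_def)
    moreover have "\<forall>x\<in>?X c. e < x" using c(5) Xm by blast
    ultimately show ?R by blast
  next
    assume ?R
    then obtain X where X: "X \<subseteq> {x. free m s x}" "card X < threshold m" "\<forall>x\<in>X. e < x"
      "deleted s \<union> X \<in> \<I>" "insert e (deleted s \<union> X) \<notin> \<I>" by blast
    from in_tuple_surj[OF X(1)] X(2) obtain c where c: "c < num_queries m" "?X c = X" by auto
    have "finite X" using fin c by blast
    then have "card (insert e X) \<le> threshold m" using X(2) by (simp add: card_insert_if)
    from in_tuple_surj[OF _ this, of s] X(1) e obtain c' where
      c': "c' < num_queries m" "?X c' = insert e X" by auto
    have "list_nth (answers r s) c = 1" using X(4) unfolding q1[OF c(1)] c(2) .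
    moreover have "list_nth (answers r s) c' = 0" using X(5) unfolding q0[OF c'(1)] c'(2) Un_insert_right .
    moreover have "\<forall>x<m. in_tuple m s c x \<longrightarrow> e < x" using c(2) X(3) by blast
    moreover have "\<forall>x<m. in_tuple m s c' x \<longleftrightarrow> x = e \<or> in_tuple m s c x" using c(2) c'(2) by blast
    ultimately show ?L using c(1) c'(1) by blast
  qed
  have gen: "{e. e < m \<and> (e \<in> T \<or> F e \<and> L e)} = T \<union> {e. F e \<and> R e}"
    if "T \<subseteq> {..<m}" "\<And>e. F e \<Longrightarrow> e < m" "\<And>e. F e \<Longrightarrow> L e \<longleftrightarrow> R e" for T F L R
    using that by blast
  have "contracted (next_state m r s (answers r s)) = set_decode (contract m s (answers r s))"
    using r by (simp add: next_state_def)
  also have "\<dots> = contracted s \<union> {e. free m s e \<and> (\<exists>X\<subseteq>{x. free m s x}. card X < threshold m \<and>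
      (\<forall>x\<in>X. e < x) \<and> deleted s \<union> X \<in> \<I> \<and> insert e (deleted s \<union> X) \<notin> \<I>)}"
    unfolding set_decode_contract
  proof (rule gen)
    show "contracted s \<subseteq> {..<m}" using inv by (simp add: invariant_def)
    show "e < m" if "free m s e" for e using that by (simp add: free_def)
  qed (rule iff)
  also have "{e. free m s e \<and> (\<exists>X\<subseteq>{x. free m s x}. card X < threshold m \<and>
      (\<forall>x\<in>X. e < x) \<and> deleted s \<union> X \<in> \<I> \<and> insert e (deleted s \<union> X) \<notin> \<I>)}
      = circuit_minima (deleted s) (contracted s) (threshold m)"
    unfolding circuit_minima_def free_set[symmetric] by blast
  finally show ?thesis .
qed

lemma invariant_next_even:
  fixes s r :: nat
  defines "s' \<equiv> next_state m r s (answers r s)"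
  assumes inv: "invariant s" and r: "r mod 2 = 0"
  shows "invariant s'" and "card {x. free m s' x} \<le> card {x. free m s x}"
    and "\<And>S. S \<subseteq> V \<Longrightarrow> \<delta> S \<noteq> {} \<Longrightarrow> \<delta> S \<inter> contracted s' = {} \<Longrightarrow> threshold m \<le> card (\<delta> S - deleted s')"
proof -
  have B: "deleted s' = deleted s" using r by (simp add: s'_def next_state_def)
  have T: "contracted s' = contracted s \<union> circuit_minima (deleted s) (contracted s) (threshold m)"
    unfolding s'_def by (rule contracted_next_even[OF inv r])
  have C: "circuit_minima (deleted s) (contracted s) (threshold m) \<subseteq> {..<m} - deleted s"
    unfolding circuit_minima_def by blast
  show "invariant s'"
    using inv C cut_separated_circuit_minima[of "deleted s" "contracted s" "threshold m"]
    unfolding invariant_def B T by blast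
  show "card {x. free m s' x} \<le> card {x. free m s x}"
    unfolding free_set B T by (intro card_mono) auto
  fix S assume S: "S \<subseteq> V" "\<delta> S \<noteq> {}" "\<delta> S \<inter> contracted s' = {}"
  show "threshold m \<le> card (\<delta> S - deleted s')"
  proof (rule ccontr)
    assume "\<not> threshold m \<le> card (\<delta> S - deleted s')"
    then have "card (\<delta> S - deleted s) \<le> threshold m" unfolding B by simp
    moreover have "deleted s \<in> \<I>" using inv by (simp add: invariant_def)
    moreover have "\<delta> S \<inter> contracted s = {}" using S(3) unfolding T by blast
    ultimately have "\<delta> S \<inter> circuit_minima (deleted s) (contracted s) (threshold m) \<noteq> {}"
      using circuit_minima_hit S by blast
    then show False using S(3) unfolding T by blast
  qed
qed

lemma invariant_next_odd:
  fixes s r :: nat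
  defines "s' \<equiv> next_state m r s (answers r s)"
  assumes inv: "invariant s" and r: "r mod 2 = 1"
    and big: "\<And>S. S \<subseteq> V \<Longrightarrow> \<delta> S \<noteq> {} \<Longrightarrow> \<delta> S \<inter> contracted s = {} \<Longrightarrow> threshold m \<le> card (\<delta> S - deleted s)"
  shows "invariant s'" and "2 * card {x. free m s' x} \<le> card {x. free m s x}"
proof -
  let ?K = "\<lambda>c. {x. in_sample m s c x}" and ?F = "{x. free m s x}"
  define a where "a = answers r s"
  define P where "P c \<longleftrightarrow> list_nth a c = 1 \<and> 2 * card (?K c) \<le> card ?F" for c
  define c0 where "c0 = sample_choice m s a"
  have K: "{x. x < m \<and> in_sample m s c x} = ?K c" for c by (auto simp: in_sample_def free_def)
  have F: "{x. x < m \<and> free m s x} = ?F" by (auto simp: free_def)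
  have c0: "c0 = (LEAST c. c = num_queries m \<or> P c)"
    unfolding c0_def sample_choice_def K F P_def ..
  have q: "list_nth a c = 1 \<longleftrightarrow> deleted s \<union> (?F - ?K c) \<in> \<I>" if "c < num_queries m" for c
    unfolding a_def answers_nth[OF that] set_decode_query_odd[OF inv r] by (rule of_bool_eq_1_iff)
  have "{..<m} \<subseteq> {..<2 ^ bitlen m}" "card {..<m} < 2 ^ bitlen m"
    using less_two_power_bitlen[of m] by auto
  moreover have "threshold m = 8 * (40 * Suc (bitlen m))" by (simp add: threshold_def)
  moreover have "deleted s \<in> \<I>" "deleted s \<inter> contracted s = {}" using inv by (auto simp: invariant_def)
  ultimately obtain ds where ds: "length ds = 40 * Suc (bitlen m)"
    "\<forall>d\<in>set ds. d < 2 ^ bitlen m * buckets m * Suc (buckets m)"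
    "2 * card {x \<in> ?F. \<exists>d\<in>set ds. in_class (2 ^ bitlen m) (buckets m) d x} \<le> card ?F"
    "deleted s \<union> (?F - {x \<in> ?F. \<exists>d\<in>set ds. in_class (2 ^ bitlen m) (buckets m) d x}) \<in> \<I>"
    unfolding free_set using indep_complement_sample[OF _ _ refl _ buckets_def _ _ big] by blast
  have "length ds \<le> threshold m" using ds(1) by (simp add: threshold_def)
  from in_sample_surj[OF ds(2)[folded digit_base_def] this] obtain c where c: "c < num_queries m"
    "\<And>x. in_sample m s c x \<longleftrightarrow> free m s x \<and> (\<exists>d\<in>set ds. in_class (2 ^ bitlen m) (buckets m) d x)"
    by blast
  have Kc: "?K c = {x \<in> ?F. \<exists>d\<in>set ds. in_class (2 ^ bitlen m) (buckets m) d x}" using c(2) by simp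
  have "P c" unfolding P_def q[OF c(1)] Kc using ds(3,4) by simp
  \<comment> \<open>The proper choice \<open>c\<close> lies below \<open>num_queries m\<close>, so
    the least solution cannot be the fallback value.\<close>
  then have "c = num_queries m \<or> P c" ..
  then have "c0 \<le> c" "c0 = num_queries m \<or> P c0"
    unfolding c0 by (rule Least_le, rule LeastI)
  then have c0': "c0 < num_queries m" "P c0" using c(1) by auto
  have B: "deleted s' = deleted s \<union> (?F - ?K c0)"
    using r set_decode_query_odd[OF inv, of 1 c0] by (simp add: s'_def next_state_def c0_def a_def)
  have T: "contracted s' = contracted s" using r by (simp add: s'_def next_state_def)
  have "deleted s' \<in> \<I>" using c0' q[OF c0'(1)] unfolding B P_def by blast
  then show "invariant s'" using inv unfolding invariant_def T by (auto simp: B free_def)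
  have "{x. free m s' x} = ?K c0" unfolding free_def[of m s'] B T by (auto simp: in_sample_def free_def)
  then show "2 * card {x. free m s' x} \<le> card {x. free m s x}" using c0'(2) by (simp add: P_def)
qed

lemma run_invariant: "invariant (run (2 * j)) \<and> 2 ^ j * card {x. free m (run (2 * j)) x} \<le> m"
proof (induction j)
  case 0
  have "card {x. free m (run 0) x} \<le> card {..<m}" by (intro card_mono) (auto simp: free_def)
  then show ?case using empty_indep by (simp add: invariant_def cut_separated_def)
next
  case (Suc j)
  define s where "s = run (2 * j)"
  define s' where "s' = run (Suc (2 * j))"
  have s': "s' = next_state m (2 * j) s (answers (2 * j) s)" by (simp add: s_def s'_def)
  have s'': "run (2 * Suc j) = next_state m (Suc (2 * j)) s' (answers (Suc (2 * j)) s')"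
    by (simp add: s'_def)
  have inv: "invariant s" and card: "2 ^ j * card {x. free m s x} \<le> m" using Suc by (simp_all add: s_def)
  have "2 * j mod 2 = 0" "Suc (2 * j) mod 2 = 1" by presburger+
  note even = invariant_next_even[OF inv this(1), folded s']
  note odd = invariant_next_odd[OF even(1) \<open>Suc (2 * j) mod 2 = 1\<close> even(3), folded s'']
  have "2 ^ Suc j * card {x. free m (run (2 * Suc j)) x} = 2 ^ j * (2 * card {x. free m (run (2 * Suc j)) x})"
    by simp
  also have "\<dots> \<le> 2 ^ j * card {x. free m s x}"
    using even(2) odd(2) by (intro mult_left_mono) linarith+
  also have "\<dots> \<le> m" by (rule card)
  finally show ?case using odd(1) by blast
qed

text \<open>After \<open>Suc (bitlen m)\<close> halvings fewer than one edge is free, because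
  \<open>m < 2 ^ bitlen m\<close>.\<close>

lemma run_basis: "basis \<I> (deleted (run (num_rounds m)))"
proof -
  define s where "s = run (num_rounds m)"
  have inv: "invariant s" and "2 ^ Suc (bitlen m) * card {x. free m s x} \<le> m"
    unfolding s_def num_rounds_def using run_invariant by blast+
  note this(2)
  also have "m < 2 ^ bitlen m" by (rule less_two_power_bitlen)
  also have "\<dots> \<le> 2 ^ Suc (bitlen m) * 1" by simp
  finally have "card {x. free m s x} < 1" unfolding mult_less_cancel1 by blast
  then have "{x. free m s x} = {}" by (simp add: free_set)
  then have "{..<m} \<subseteq> deleted s \<union> contracted s" unfolding free_set by blast
  then have "deleted s \<union> contracted s = {..<m}"
    using inv indep_subset_E[of "deleted s"] by (auto simp: invariant_def)
  then show ?thesis using inv basis_if_cut_separated unfolding s_def[symmetric] invariant_def by blast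
qed

definition batch :: "nat \<Rightarrow> bool list" where
  "batch r = map (\<lambda>c. set_decode (query m (run r) r c) \<in> \<I>) [0..<num_queries m]"

lemma answers_encode_batches:
  "answers_encode (map batch [0..<j]) = list_encode (map (\<lambda>r. answers r (run r)) [0..<j])"
  by (simp add: answers_encode_def batch_def answers_def comp_def)

text \<open>The replay up to round \<open>r\<close> reads only the first \<open>r\<close> batches,
  so any longer history gives the same state.\<close>

lemma state_batches:
  "r \<le> j \<Longrightarrow> state m (answers_encode (map batch [0..<j])) r = run r"
proof (induction r)
  case 0
  show ?case by (simp add: state_def)
next
  case (Suc r)
  have "list_nth (answers_encode (map batch [0..<j])) r = answers r (run r)"
    unfolding answers_encode_batches using Suc.prems by (subst list_nth_encode) auto
  then show ?case using Suc by (simp add: state_def)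
qed

lemma basis_algorithm_batches:
  "basis_algorithm m (map batch [0..<j]) = (if j < num_rounds m
     then Query (map (\<lambda>c. set_decode (query m (run j) j c)) [0..<num_queries m])
     else Output (deleted (run j)))"
proof -
  have "list_len (answers_encode (map batch [0..<j])) = j"
    by (simp add: answers_encode_batches list_len_encode)
  moreover have "sum_decode (2 * x) = Inl x" "sum_decode (Suc (2 * x)) = Inr x" for x
    by (simp_all add: sum_decode_def)
  ultimately show ?thesis
    by (simp add: basis_algorithm_def action_code_def action_decode_def state_batches comp_def)
qed

lemma transcript_batches:
  "j \<le> num_rounds m \<Longrightarrow> transcript basis_algorithm m (\<lambda>S. S \<in> \<I>) j = map batch [0..<j]"
proof (induction j)
  case (Suc j)
  then have IH: "transcript basis_algorithm m (\<lambda>S. S \<in> \<I>) j = map batch [0..<j]" and "j < num_rounds m"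
    by simp_all
  then show ?case by (simp add: basis_algorithm_batches Let_def batch_def[of j] comp_def)
qed simp

lemma halts_with_basis:
  "halts_with basis_algorithm m (\<lambda>S. S \<in> \<I>) (num_rounds m) (num_queries m) (deleted (run (num_rounds m)))"
  unfolding halts_with_def
proof (intro conjI allI impI)
  fix j assume "j < num_rounds m"
  then have A: "basis_algorithm m (transcript basis_algorithm m (\<lambda>S. S \<in> \<I>) j)
    = Query (map (\<lambda>c. set_decode (query m (run j) j c)) [0..<num_queries m])"
    by (simp add: transcript_batches basis_algorithm_batches)
  show "\<exists>Qs. basis_algorithm m (transcript basis_algorithm m (\<lambda>S. S \<in> \<I>) j) = Query Qs \<and>
      length Qs \<le> num_queries m \<and> (\<forall>S\<in>set Qs. S \<subseteq> {..<m})"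
    unfolding A by (intro exI conjI, rule refl) (auto simp: set_decode_query)
next
  show "basis_algorithm m (transcript basis_algorithm m (\<lambda>S. S \<in> \<I>) (num_rounds m))
    = Output (deleted (run (num_rounds m)))"
    by (simp add: transcript_batches basis_algorithm_batches)
qed

end

lemma basis_algorithm_correct:
  assumes "cographic_matroid {..<m} \<I>"
  shows "\<exists>B. halts_with basis_algorithm m (\<lambda>S. S \<in> \<I>) (num_rounds m) (num_queries m) B \<and> basis \<I> B"
proof -
  from assms obtain V :: "nat set" and ends where
    G: "multigraph V {..<m} ends" "\<I> = cographic_indep V {..<m} ends"
    unfolding cographic_matroid_def by blast
  interpret cographic_oracle V m ends by unfold_locales (rule G(1))
  show ?thesis unfolding G(2) using halts_with_basis run_basis by blast
qed

section \<open>Asymptotic bounds\<close>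

lemma num_queries_le: "num_queries m \<le> 2 ^ (8000 * (Suc (bitlen m))\<^sup>2)"
proof -
  let ?l = "bitlen m"
  have "Suc ?l \<le> 2 ^ ?l" by (rule Suc_leI[OF less_exp])
  \<comment> \<open>6 * 320 = 1920, and the slack up to 2 ^ 11 = 2048 absorbs the successor.\<close>
  then have "Suc (buckets m) \<le> 2 ^ 11 * 2 ^ ?l" "buckets m \<le> 2 ^ 11 * 2 ^ ?l"
    unfolding buckets_def threshold_def by simp_all
  then have "digit_base m \<le> 2 ^ ?l * (2 ^ 11 * 2 ^ ?l) * (2 ^ 11 * 2 ^ ?l)"
    unfolding digit_base_def by (intro mult_le_mono) auto
  also have "\<dots> = 2 ^ (?l + (11 + ?l) + (11 + ?l))" by (simp only: power_add)
  also have "\<dots> \<le> 2 ^ (25 * Suc ?l)" by (intro power_increasing) auto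
  finally have "num_queries m \<le> (2 ^ (25 * Suc ?l)) ^ threshold m"
    unfolding num_queries_def by (intro power_mono) auto
  also have "\<dots> = 2 ^ (25 * Suc ?l * (320 * Suc ?l))" unfolding threshold_def by (simp only: power_mult)
  also have "25 * Suc ?l * (320 * Suc ?l) = 8000 * (Suc ?l)\<^sup>2" by (simp add: power2_eq_square algebra_simps)
  finally show ?thesis .
qed

lemma bitlen_le_log:
  assumes "4 \<le> m" shows "real (Suc (bitlen m)) \<le> 2 * log 2 (real m)" and "1 \<le> log 2 (log 2 (real m))"
proof -
  have "log 2 (2 ^ 2) \<le> log 2 (real m)" using assms by (subst log_le_cancel_iff) auto
  then have 2: "2 \<le> log 2 (real m)" by (subst (asm) log_nat_power) auto
  then have "log 2 2 \<le> log 2 (log 2 (real m))" by (subst log_le_cancel_iff) auto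
  then show "1 \<le> log 2 (log 2 (real m))" by simp
  obtain l where l: "bitlen m = Suc l"
    using less_two_power_bitlen[of m] assms by (cases "bitlen m") auto
  have "\<not> m < 2 ^ l" using not_less_Least[of l "\<lambda>l. m < 2 ^ l"] l unfolding bitlen_def[symmetric] by simp
  then have "real (2 ^ l) \<le> real m" by (subst of_nat_le_iff) simp
  then have "log 2 (2 ^ l) \<le> log 2 (real m)" using assms by (subst log_le_cancel_iff) auto
  then have "real l \<le> log 2 (real m)" by (subst (asm) log_nat_power) auto
  \<comment> \<open>\<open>Suc (bitlen m)\<close> is \<open>l + 2\<close>, and for
    \<open>4 \<le> m\<close> the summand 2 is itself at most the logarithm.\<close>
  then show "real (Suc (bitlen m)) \<le> 2 * log 2 (real m)" using 2 l by simp
qed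

theorem theorem1p5:
  "\<exists>(A :: algorithm) (R :: nat \<Rightarrow> nat) (Q :: nat \<Rightarrow> nat) (g :: nat \<Rightarrow> real).
     uniform_algorithm A \<and>
     (\<lambda>m. real (R m)) \<in> O(\<lambda>m. log 2 (real m) * log 2 (log 2 (real m))) \<and>
     g \<in> O(\<lambda>m. (log 2 (real m))\<^sup>2) \<and>
     (\<forall>m. real (Q m) \<le> 2 powr g m) \<and>
     (\<forall>m \<I>. cographic_matroid {..<m} \<I> \<longrightarrow>
        (\<exists>k B. k \<le> R m \<and> halts_with A m (\<lambda>S. S \<in> \<I>) k (Q m) B \<and> basis \<I> B))"
proof -
  \<comment> \<open>The bound on the queries must hold for every \<open>m\<close>, and at
    \<open>m = 1\<close> the logarithm vanishes; hence \<open>bitlen\<close>.\<close>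
  define g where "g m = real (8000 * (Suc (bitlen m))\<^sup>2)" for m
  have R: "(\<lambda>m. real (num_rounds m)) \<in> O(\<lambda>m. log 2 (real m) * log 2 (log 2 (real m)))"
  proof (rule bigoI[of _ 4])
    show "\<forall>\<^sub>F m in sequentially. norm (real (num_rounds m)) \<le> 4 * norm (log 2 (real m) * log 2 (log 2 (real m)))"
      using eventually_ge_at_top[of 4]
    proof eventually_elim
      case (elim m)
      note b = bitlen_le_log[OF elim]
      have l: "0 \<le> log 2 (real m)" using b(1) of_nat_0_le_iff[of "Suc (bitlen m)"] by linarith
      have "real (num_rounds m) \<le> 4 * (log 2 (real m) * 1)" using b(1) by (simp add: num_rounds_def)
      \<comment> \<open>The number of rounds is already linear in the logarithm; the iterated
        logarithm enters only as a factor of at least 1.\<close>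
      also have "\<dots> \<le> 4 * (log 2 (real m) * log 2 (log 2 (real m)))"
        using b(2) l by (intro mult_left_mono) auto
      finally show ?case by simp
    qed
  qed
  have g: "g \<in> O(\<lambda>m. (log 2 (real m))\<^sup>2)"
  proof (rule bigoI[of _ 32000])
    show "\<forall>\<^sub>F m in sequentially. norm (g m) \<le> 32000 * norm ((log 2 (real m))\<^sup>2)"
      using eventually_ge_at_top[of 4]
    proof eventually_elim
      case (elim m)
      have "(real (Suc (bitlen m)))\<^sup>2 \<le> (2 * log 2 (real m))\<^sup>2"
        by (intro power_mono bitlen_le_log[OF elim]) simp
      then show ?case by (simp add: g_def power_mult_distrib)
    qed
  qed
  have Q: "real (num_queries m) \<le> 2 powr g m" for m
  proof -
    have "real (num_queries m) \<le> real (2 ^ (8000 * (Suc (bitlen m))\<^sup>2))"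
      using num_queries_le by (rule of_nat_mono)
    also have "\<dots> = 2 powr g m" unfolding g_def by (subst powr_realpow) auto
    finally show ?thesis .
  qed
  show ?thesis
    using uniform_basis_algorithm R g Q basis_algorithm_correct by blast
qed

end
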